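(* Let $\{\mathcal K_{\mathcal N}\}$ be a set of solutions of the generalized dual reflection equations, acting on the tensor product of the auxiliary spaces labelled by $\mathcal N$, on the quantum space labelled by $q'$ and on a possible boundary space labelled by $q'_b$. Let $\{\mathcal T_{\mathcal N}\}$ be a set of solutions of the generalized reflection equations, acting on the tensor product of the auxiliary spaces labelled by $\mathcal N$, on the quantum space labelled by $q$ and on the boundary space labelled by $q_b$. Then the trace operators acting on the quantum space $q\otimes q_b\otimes q'\otimes q'_b$, $$H_{\mathcal N}=\mathrm{Tr}_{\mathcal N}\Big(\mathcal K^{*}_{\mathcal N}(\lambda_{\mathcal N})\,\mathcal T_{\mathcal N}(\lambda_{\mathcal N})\Big),\qquad \mathcal K^{*}_{\mathcal N}=\mathcal K_{\mathcal N}^{\,t_{q'q'_b}},$$ form a family of mutually commuting operators: $$[H_{\mathcal N},H_{\mathcal M'}]=0$$ for all ordered sets $\mathcal N=\langle1,\dots,n\rangle$, $\mathcal M'=\langle1',\dots,m'\rangle$ and all values of the spectral parameters $\lambda_{\mathcal N},\lambda_{\mathcal M'}$.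
   Context: $V$ is a finite-dimensional complex vector space (auxiliary space); $V_i$ denotes a copy of $V$ labelled by $i$, and subscripts indicate the copies on which an operator acts. To each label $i$ is attached a spectral parameter $\lambda_i\in\mathbb C$. All identities hold for generic values of the parameters (as identities of matrix-valued functions). $R(\lambda)\in\mathrm{End}(V\otimes V)$ is a c-number matrix, $R_{21}=P_{12}R_{12}P_{12}$ with $P_{12}$ the permutation of the two factors, and $t_i$ denotes transposition in the space $V_i$. Standing assumptions on $R$: (I) Yang--Baxter equation: $R_{12}(\lambda_1-\lambda_2)R_{13}(\lambda_1)R_{23}(\lambda_2)=R_{23}(\lambda_2)R_{13}(\lambda_1)R_{12}(\lambda_1-\lambda_2)$. (II) $R_{12}(\lambda)=R_{21}(\lambda)^{t_1t_2}$. (III) Unitarity $R_{12}(\lambda)R_{21}(-\lambda)\propto 1$; crossing $R_{12}(\lambda)=V_1R_{12}^{t_2}(-\lambda-\rho)V_1=V_2^{t_2}R_{12}^{t_1}(-\lambda-\rho)V_2^{t_2}$; crossing-unitarity $R_{21}(\lambda)^{t_1}M_1^{-1}R_{12}(-\lambda-2\rho)^{t_1}M_1\propto 1$; and $[R_{12}(\lambda),M_1M_2]=0$. Here (in these crossing formulas only) $V_i$ denotes a c-number matrix $V$ with $V^2=1$ acting on the $i$-th space, $M=V^tV$, and $\rho$ is a fixed constant. The sign $\propto$ means equality up to a nonzero scalar function. For an ordered set of labels $\mathcal X=\langle x_1,\dots,x_a\rangle$, $M_{\mathcal X}=M_{x_1}\cdots M_{x_a}$, and $\mathrm{Tr}_{\mathcal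 X}$ is the trace over $V_{x_1}\otimes\cdots\otimes V_{x_a}$. Fused $R$-matrices: for disjoint ordered sets of labels $\mathcal X=\langle x_1,\dots,x_a\rangle$ and $\mathcal Y=\langle y_1,\dots,y_b\rangle$, $$R_{\mathcal X\mathcal Y}=\big(R_{x_1y_1}R_{x_2y_1}\cdots R_{x_ay_1}\big)\big(R_{x_1y_2}\cdots R_{x_ay_2}\big)\cdots\big(R_{x_1y_b}\cdots R_{x_ay_b}\big).$$ An argument such as $\epsilon\lambda_{\mathcal X}+\epsilon'\lambda_{\mathcal Y}+c$ means that each factor $R_{xy}$ is evaluated at $\epsilon\lambda_x+\epsilon'\lambda_y+c$. For an ordered set $\mathcal N=\langle 1,\dots,n\rangle$, $\bar{\mathcal N}=\langle n,n-1,\dots,1\rangle$ is the set in reversed order. A set of solutions of the generalized reflection equations is a family $\mathcal T_{\mathcal N}(\lambda_{\mathcal N})$, one for each length $n\ge1$, of matrices acting on $V_1\otimes\cdots\otimes V_n$ with entries operators on the quantum space $q\otimes q_b$ (the same for all $\mathcal N$), such that for all disjoint $\mathcal N,\mathcal M'$ $$\mathcal T_{\mathcal N}(\lambda_{\mathcal N})R_{\mathcal M'\mathcal N}(\lambda_{\mathcal N}+\lambda_{\mathcal M'})\mathcal T_{\mathcal M'}(\lambda_{\mathcal M'})R_{\bar{\mathcal N}\mathcal M'}(-\lambda_{\bar{\mathcal N}}+\lambda_{\mathcal M'})=R_{\mathcal M'\bar{\mathcal N}}(-\lambda_{\bar{\mathcal N}}+\lambda_{\mathcal M'})\mathcal T_{\mathcal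 M'}(\lambda_{\mathcal M'})R_{\mathcal N\mathcal M'}(\lambda_{\mathcal N}+\lambda_{\mathcal M'})\mathcal T_{\mathcal N}(\lambda_{\mathcal N}).$$ A set of solutions of the generalized dual reflection equations is a family $\mathcal K_{\mathcal N}(\lambda_{\mathcal N})$ of matrices acting on $V_1\otimes\cdots\otimes V_n$ with entries operators on $q'\otimes q'_b$, such that for all disjoint $\mathcal N,\mathcal M'$ $$\mathcal K_{\mathcal N}(\lambda_{\mathcal N})M_{\mathcal M'}R_{\bar{\mathcal M}'\bar{\mathcal N}}(-\lambda_{\bar{\mathcal N}}-\lambda_{\bar{\mathcal M}'}-2\rho)M_{\mathcal M'}^{-1}\mathcal K_{\mathcal M'}(\lambda_{\mathcal M'})R_{\mathcal N\bar{\mathcal M}'}(\lambda_{\mathcal N}-\lambda_{\bar{\mathcal M}'})$$ $$=R_{\bar{\mathcal M}'\mathcal N}(\lambda_{\mathcal N}-\lambda_{\bar{\mathcal M}'})\mathcal K_{\mathcal M'}(\lambda_{\mathcal M'})M_{\mathcal M'}^{-1}R_{\bar{\mathcal N}\bar{\mathcal M}'}(-\lambda_{\bar{\mathcal N}}-\lambda_{\bar{\mathcal M}'}-2\rho)M_{\mathcal M'}\mathcal K_{\mathcal N}(\lambda_{\mathcal N}).$$ $t_{q'q'_b}$ is a transposition antimorphism (a linear map reversing products) on the algebra of operators on $q'\otimes q'_b$, assumed to exist and applied entrywise to $\mathcal K_{\mathcal N}$ (it does not transpose the auxiliary spaces). The spaces $q\otimes q_b$ and $q'\otimes q'_b$ are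 independent, so that all entries of $\mathcal K_{\mathcal N}$ (and of $\mathcal K^*_{\mathcal N}$) commute with all entries of $\mathcal T_{\mathcal M'}$. *)

theory Defs
  imports "HOL-Analysis.Analysis" "HOL-Library.Poly_Mapping"
begin

section \<open>Operators on (possibly infinite-dimensional) quantum spaces\<close>

text \<open>A complex vector space is given by a Hamel basis, i.e. as the space of finitely
  supported functions from a basis type; the tensor product of two such spaces is the space
  over the product of the two basis types.\<close>

definition vscale :: "complex \<Rightarrow> ('k \<Rightarrow>\<^sub>0 complex) \<Rightarrow> ('k \<Rightarrow>\<^sub>0 complex)" where
  "vscale c = Poly_Mapping.map ((*) c)"

lemma lookup_vscale [simp]: "Poly_Mapping.lookup (vscale c v) k = c * Poly_Mapping.lookup v k"
  by (simp add: vscale_def Poly_Mapping.map.rep_eq when_def)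

interpretation fsv: vector_space "vscale :: complex \<Rightarrow> ('k \<Rightarrow>\<^sub>0 complex) \<Rightarrow> _"
  by unfold_locales (auto intro!: poly_mapping_eqI simp: lookup_add algebra_simps)

typedef 'k operator =
  "{f :: ('k \<Rightarrow>\<^sub>0 complex) \<Rightarrow> ('k \<Rightarrow>\<^sub>0 complex). Vector_Spaces.linear vscale vscale f}"
  morphisms apply_op Operator
  using fsv.linear_id by blast

setup_lifting type_definition_operator

lemma linear_vscale_iff:
  "Vector_Spaces.linear vscale vscale f \<longleftrightarrow>
     (\<forall>v w. f (v + w) = f v + f w) \<and> (\<forall>c v. f (vscale c v) = vscale c (f v))"
  for f :: "('k \<Rightarrow>\<^sub>0 complex) \<Rightarrow> ('l \<Rightarrow>\<^sub>0 complex)"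
  by (auto simp: Vector_Spaces.linear_iff fsv.vector_space_axioms)

instantiation operator :: (type) ring_1
begin

lift_definition zero_operator :: "'a operator" is "\<lambda>_. 0"
  by (simp add: linear_vscale_iff)

lift_definition one_operator :: "'a operator" is "\<lambda>v. v"
  by (simp add: linear_vscale_iff)

lift_definition plus_operator :: "'a operator \<Rightarrow> 'a operator \<Rightarrow> 'a operator"
  is "\<lambda>f g v. f v + g v"
  by (simp add: linear_vscale_iff fsv.scale_right_distrib)

lift_definition uminus_operator :: "'a operator \<Rightarrow> 'a operator" is "\<lambda>f v. - f v"
  by (simp add: linear_vscale_iff)

lift_definition minus_operator :: "'a operator \<Rightarrow> 'a operator \<Rightarrow> 'a operator"
  is "\<lambda>f g v. f v - g v"
  by (simp add: linear_vscale_iff fsv.scale_right_diff_distrib)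

lift_definition times_operator :: "'a operator \<Rightarrow> 'a operator \<Rightarrow> 'a operator"
  is "\<lambda>f g v. f (g v)"
  by (simp add: linear_vscale_iff)

instance
proof
  fix a b c :: "'a operator"
  show "a * b * c = a * (b * c)" by transfer simp
  show "1 * a = a" by transfer simp
  show "a * 1 = a" by transfer simp
  show "a + b + c = a + (b + c)" by transfer (simp add: add.assoc)
  show "a + b = b + a" by transfer (simp add: add.commute)
  show "0 + a = a" by transfer simp
  show "- a + a = 0" by transfer simp
  show "a - b = a + - b" by transfer simp
  show "(a + b) * c = a * c + b * c" by transfer simp
  show "a * (b + c) = a * b + a * c" by transfer (simp add: linear_vscale_iff)
  show "(0 :: 'a operator) \<noteq> 1"
  proof
    assume "(0 :: 'a operator) = 1"
    then have "Poly_Mapping.single (undefined :: 'a) (1 :: complex) = 0"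
      by (metis zero_operator.rep_eq one_operator.rep_eq)
    then have "Poly_Mapping.lookup (Poly_Mapping.single (undefined :: 'a) (1 :: complex)) undefined = 0"
      by (simp only: lookup_zero)
    then show False by (simp only: lookup_single_eq one_neq_zero)
  qed
qed

end

lift_definition op_scale :: "complex \<Rightarrow> 'k operator \<Rightarrow> 'k operator"
  is "\<lambda>c f v. vscale c (f v)"
  by (simp add: linear_vscale_iff fsv.scale_right_distrib mult.commute)

definition vec_tensor :: "('k \<Rightarrow>\<^sub>0 complex) \<Rightarrow> ('l \<Rightarrow>\<^sub>0 complex) \<Rightarrow> ('k \<times> 'l \<Rightarrow>\<^sub>0 complex)" where
  "vec_tensor v w =
     (\<Sum>i\<in>Poly_Mapping.keys v. \<Sum>j\<in>Poly_Mapping.keys w.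
        Poly_Mapping.single (i, j) (Poly_Mapping.lookup v i * Poly_Mapping.lookup w j))"

text \<open>The tensor product of operators, determined by its values on the product basis.\<close>

lift_definition op_tensor :: "'k operator \<Rightarrow> 'l operator \<Rightarrow> ('k \<times> 'l) operator"
  is "\<lambda>f g v. \<Sum>(i, j)\<in>Poly_Mapping.keys v. vscale (Poly_Mapping.lookup v (i, j))
        (vec_tensor (f (Poly_Mapping.single i 1)) (g (Poly_Mapping.single j 1)))"
proof -
  fix f :: "('k \<Rightarrow>\<^sub>0 complex) \<Rightarrow> ('k \<Rightarrow>\<^sub>0 complex)" and g :: "('l \<Rightarrow>\<^sub>0 complex) \<Rightarrow> ('l \<Rightarrow>\<^sub>0 complex)"
  define b where "b p = vec_tensor (f (Poly_Mapping.single (fst p) 1))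
    (g (Poly_Mapping.single (snd p) 1))" for p
  define F where "F v = (\<Sum>p\<in>Poly_Mapping.keys v. vscale (Poly_Mapping.lookup v p) (b p))" for v
  have sup: "F v = (\<Sum>p\<in>S. vscale (Poly_Mapping.lookup v p) (b p))" if "finite S" "Poly_Mapping.keys v \<subseteq> S" for v S
    unfolding F_def by (rule sum.mono_neutral_left) (use that in \<open>auto simp: in_keys_iff\<close>)
  have "F (v + w) = F v + F w" for v w
  proof -
    have "Poly_Mapping.keys (v + w) \<subseteq> Poly_Mapping.keys v \<union> Poly_Mapping.keys w" by (rule Poly_Mapping.keys_add)
    then show ?thesis
      by (simp add: sup[of "Poly_Mapping.keys v \<union> Poly_Mapping.keys w"] lookup_add fsv.scale_left_distrib sum.distrib)
  qed
  moreover have "F (vscale c v) = vscale c (F v)" for c v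
  proof -
    have "Poly_Mapping.keys (vscale c v) \<subseteq> Poly_Mapping.keys v" by (auto simp: in_keys_iff)
    then show ?thesis
      by (simp add: sup[of "Poly_Mapping.keys v"] fsv.scale_sum_right)
  qed
  ultimately have "Vector_Spaces.linear vscale vscale F"
    by (simp add: linear_vscale_iff)
  then show "Vector_Spaces.linear vscale vscale (\<lambda>v. \<Sum>(i, j)\<in>Poly_Mapping.keys v. vscale (Poly_Mapping.lookup v (i, j))
        (vec_tensor (f (Poly_Mapping.single i 1)) (g (Poly_Mapping.single j 1))))"
    by (simp add: F_def[abs_def] b_def case_prod_unfold)
qed

definition on_left :: "'k operator \<Rightarrow> ('k \<times> 'l) operator" where
  "on_left A = op_tensor A 1"

definition on_right :: "'l operator \<Rightarrow> ('k \<times> 'l) operator" where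
  "on_right B = op_tensor 1 B"

definition unital_subalgebra :: "'k operator set \<Rightarrow> bool" where
  "unital_subalgebra \<A> \<longleftrightarrow> 1 \<in> \<A> \<and>
     (\<forall>a\<in>\<A>. \<forall>b\<in>\<A>. a + b \<in> \<A> \<and> a * b \<in> \<A>) \<and> (\<forall>c. \<forall>a\<in>\<A>. op_scale c a \<in> \<A>)"

text \<open>In infinite dimension the algebra of all linear endomorphisms need not carry a useful
  transposition, so the transposition lives on some algebra of operators (which may be
  everything).\<close>

definition transposition_antimorphism ::
  "'k operator set \<Rightarrow> ('k operator \<Rightarrow> 'k operator) \<Rightarrow> bool" where
  "transposition_antimorphism \<A> t \<longleftrightarrow> unital_subalgebra \<A> \<and> t ` \<A> \<subseteq> \<A> \<and>
     (\<forall>a\<in>\<A>. \<forall>b\<in>\<A>. t (a + b) = t a + t b \<and> t (a * b) = t b * t a) \<and>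
     (\<forall>c. \<forall>a\<in>\<A>. t (op_scale c a) = op_scale c (t a))"


section \<open>Matrices on labelled copies of the auxiliary space\<close>

text \<open>The auxiliary space is \<open>complex ^ 'v\<close>; labels are natural numbers. For a finite set
  \<open>X\<close> of labels, a basis vector of the tensor product of the copies in \<open>X\<close> is an element of
  \<open>confs X\<close>. An element of type \<open>('v, 'a) aux\<close> is used as a matrix with rows and columns in
  \<open>confs X\<close> and entries in the ring \<open>'a\<close>; its values elsewhere are irrelevant, and equality
  of such matrices is \<open>aux_eq X\<close>.\<close>

type_synonym ('v, 'a) aux = "(nat \<Rightarrow> 'v) \<Rightarrow> (nat \<Rightarrow> 'v) \<Rightarrow> 'a"

abbreviation confs :: "nat set \<Rightarrow> (nat \<Rightarrow> 'v) set" where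
  "confs X \<equiv> X \<rightarrow>\<^sub>E UNIV"

definition aux_eq :: "nat set \<Rightarrow> ('v, 'a) aux \<Rightarrow> ('v, 'a) aux \<Rightarrow> bool" where
  "aux_eq X A B \<longleftrightarrow> (\<forall>s\<in>confs X. \<forall>u\<in>confs X. A s u = B s u)"

definition aux_one :: "('v, 'a::ring_1) aux" where
  "aux_one s u = (if s = u then 1 else 0)"

definition aux_mult :: "nat set \<Rightarrow> ('v::finite, 'a::ring_1) aux \<Rightarrow> ('v, 'a) aux \<Rightarrow> ('v, 'a) aux" where
  "aux_mult X A B s u = (\<Sum>r\<in>confs X. A s r * B r u)"

definition aux_prod :: "nat set \<Rightarrow> ('v::finite, 'a::ring_1) aux list \<Rightarrow> ('v, 'a) aux" where
  "aux_prod X As = foldr (aux_mult X) As aux_one"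

definition aux_trace :: "nat set \<Rightarrow> ('v::finite, 'a::ring_1) aux \<Rightarrow> 'a" where
  "aux_trace X A = (\<Sum>s\<in>confs X. A s s)"

definition aux_proportional :: "nat set \<Rightarrow> ('v, complex) aux \<Rightarrow> ('v, complex) aux \<Rightarrow> bool" where
  "aux_proportional X A B \<longleftrightarrow> (\<exists>c. c \<noteq> 0 \<and> aux_eq X A (\<lambda>s u. c * B s u))"

text \<open>Transposition in the copy with label \<open>x\<close>.\<close>

definition ptrans :: "nat \<Rightarrow> ('v, 'a) aux \<Rightarrow> ('v, 'a) aux" where
  "ptrans x A s u = A (s(x := u x)) (u(x := s x))"

definition cnum :: "('v, complex) aux \<Rightarrow> ('v, 'k operator) aux" where
  "cnum A s u = op_scale (A s u) 1"

text \<open>A matrix on \<open>n\<close> tensor factors, acting on the copies listed in \<open>xs\<close> (in this order)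
  and as the identity on all other copies.\<close>

definition place :: "nat list \<Rightarrow> ('v list \<Rightarrow> 'v list \<Rightarrow> 'a::zero) \<Rightarrow> ('v, 'a) aux" where
  "place xs A s u = (if \<forall>z. z \<notin> set xs \<longrightarrow> s z = u z then A (map s xs) (map u xs) else 0)"

definition place1 :: "complex^'v^'v \<Rightarrow> nat \<Rightarrow> ('v, complex) aux" where
  "place1 A x = place [x] (\<lambda>i j. A $ (i ! 0) $ (j ! 0))"

text \<open>\<open>place2 A x y\<close> is the operator usually written \<open>A\<close> with subscript \<open>xy\<close>; in particular
  \<open>place2 A 2 1\<close> is the conjugate of \<open>place2 A 1 2\<close> by the permutation of the two factors.\<close>

definition place2 :: "complex^('v \<times> 'v)^('v::finite \<times> 'v) \<Rightarrow> nat \<Rightarrow> nat \<Rightarrow> ('v, complex) aux" where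
  "place2 A x y = place [x, y] (\<lambda>i j. A $ (i ! 0, i ! 1) $ (j ! 0, j ! 1))"


section \<open>Structure matrices\<close>

text \<open>The set \<open>E\<close> collects the exceptional values of the spectral parameter: poles of \<open>R\<close> and
  zeros or poles of the scalar functions hidden in the proportionality signs. An identity is
  required whenever no \<open>R\<close>-matrix in it is evaluated at an exceptional value.\<close>

definition yang_baxter :: "complex set \<Rightarrow> (complex \<Rightarrow> complex^('v \<times> 'v)^('v::finite \<times> 'v)) \<Rightarrow> bool" where
  "yang_baxter E R \<longleftrightarrow> (\<forall>l1 l2. l1 \<notin> E \<and> l2 \<notin> E \<and> l1 - l2 \<notin> E \<longrightarrow>
     aux_eq {1, 2, 3}
       (aux_prod {1, 2, 3} [place2 (R (l1 - l2)) 1 2, place2 (R l1) 1 3, place2 (R l2) 2 3])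
       (aux_prod {1, 2, 3} [place2 (R l2) 2 3, place2 (R l1) 1 3, place2 (R (l1 - l2)) 1 2]))"

definition transposition_symmetric ::
  "complex set \<Rightarrow> (complex \<Rightarrow> complex^('v \<times> 'v)^('v::finite \<times> 'v)) \<Rightarrow> bool" where
  "transposition_symmetric E R \<longleftrightarrow> (\<forall>l. l \<notin> E \<longrightarrow>
     aux_eq {1, 2} (place2 (R l) 1 2) (ptrans 1 (ptrans 2 (place2 (R l) 2 1))))"

definition unitary_R :: "complex set \<Rightarrow> (complex \<Rightarrow> complex^('v \<times> 'v)^('v::finite \<times> 'v)) \<Rightarrow> bool" where
  "unitary_R E R \<longleftrightarrow> (\<forall>l. l \<notin> E \<and> - l \<notin> E \<longrightarrow>
     aux_proportional {1, 2} (aux_prod {1, 2} [place2 (R l) 1 2, place2 (R (- l)) 2 1]) aux_one)"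

definition crossing_R ::
  "complex set \<Rightarrow> complex \<Rightarrow> complex^'v^'v \<Rightarrow> (complex \<Rightarrow> complex^('v \<times> 'v)^('v::finite \<times> 'v)) \<Rightarrow> bool" where
  "crossing_R E \<rho> V R \<longleftrightarrow> (\<forall>l. l \<notin> E \<and> - l - \<rho> \<notin> E \<longrightarrow>
     aux_eq {1, 2} (place2 (R l) 1 2)
       (aux_prod {1, 2} [place1 V 1, ptrans 2 (place2 (R (- l - \<rho>)) 1 2), place1 V 1]) \<and>
     aux_eq {1, 2} (place2 (R l) 1 2)
       (aux_prod {1, 2} [place1 (transpose V) 2, ptrans 1 (place2 (R (- l - \<rho>)) 1 2),
          place1 (transpose V) 2]))"

definition crossing_unitary_R ::
  "complex set \<Rightarrow> complex \<Rightarrow> complex^'v^'v \<Rightarrow> (complex \<Rightarrow> complex^('v \<times> 'v)^('v::finite \<times> 'v)) \<Rightarrow> bool" where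
  "crossing_unitary_R E \<rho> M R \<longleftrightarrow> (\<forall>l. l \<notin> E \<and> - l - 2 * \<rho> \<notin> E \<longrightarrow>
     aux_proportional {1, 2}
       (aux_prod {1, 2} [ptrans 1 (place2 (R l) 2 1), place1 (matrix_inv M) 1,
          ptrans 1 (place2 (R (- l - 2 * \<rho>)) 1 2), place1 M 1])
       aux_one)"

definition commutes_with_MM ::
  "complex set \<Rightarrow> complex^'v^'v \<Rightarrow> (complex \<Rightarrow> complex^('v \<times> 'v)^('v::finite \<times> 'v)) \<Rightarrow> bool" where
  "commutes_with_MM E M R \<longleftrightarrow> (\<forall>l. l \<notin> E \<longrightarrow>
     aux_eq {1, 2}
       (aux_prod {1, 2} [place2 (R l) 1 2, place1 M 1, place1 M 2])
       (aux_prod {1, 2} [place1 M 1, place1 M 2, place2 (R l) 1 2]))"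

definition crossing_M :: "complex^'v^'v \<Rightarrow> complex^'v^'v::finite" where
  "crossing_M V = transpose V ** V"

definition standing_assumptions ::
  "complex set \<Rightarrow> complex \<Rightarrow> complex^'v^'v \<Rightarrow> (complex \<Rightarrow> complex^('v \<times> 'v)^('v::finite \<times> 'v)) \<Rightarrow> bool" where
  "standing_assumptions E \<rho> V R \<longleftrightarrow>
     yang_baxter E R \<and> transposition_symmetric E R \<and>
     V ** V = mat 1 \<and> unitary_R E R \<and> crossing_R E \<rho> V R \<and>
     crossing_unitary_R E \<rho> (crossing_M V) R \<and> commutes_with_MM E (crossing_M V) R"


section \<open>Fused matrices and the generalized reflection equations\<close>

text \<open>The factor acting on the copies \<open>x\<close> and \<open>y\<close> is evaluated at \<open>arg x y\<close>.\<close>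

definition fused_R :: "nat set \<Rightarrow> (complex \<Rightarrow> complex^('v \<times> 'v)^('v::finite \<times> 'v)) \<Rightarrow>
    (nat \<Rightarrow> nat \<Rightarrow> complex) \<Rightarrow> nat list \<Rightarrow> nat list \<Rightarrow> ('v, complex) aux" where
  "fused_R X R arg xs ys = aux_prod X [place2 (R (arg x y)) x y. y \<leftarrow> ys, x \<leftarrow> xs]"

definition fused1 :: "nat set \<Rightarrow> complex^'v^'v \<Rightarrow> nat list \<Rightarrow> ('v::finite, complex) aux" where
  "fused1 X A xs = aux_prod X [place1 A x. x \<leftarrow> xs]"

text \<open>A family of matrices, one for each length \<open>n\<close>: it takes the list of the \<open>n\<close> spectral
  parameters and returns a matrix on \<open>n\<close> copies with operator entries.\<close>

type_synonym ('v, 'k) family = "complex list \<Rightarrow> 'v list \<Rightarrow> 'v list \<Rightarrow> 'k operator"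

abbreviation at_labels :: "('v, 'k) family \<Rightarrow> (nat \<Rightarrow> complex) \<Rightarrow> nat list \<Rightarrow> ('v, 'k operator) aux" where
  "at_labels T l ns \<equiv> place ns (T (map l ns))"

definition label_lists :: "nat list \<Rightarrow> nat list \<Rightarrow> bool" where
  "label_lists ns ms \<longleftrightarrow> ns \<noteq> [] \<and> ms \<noteq> [] \<and> distinct (ns @ ms)"

definition reflection_regular ::
  "complex set \<Rightarrow> (nat \<Rightarrow> complex) \<Rightarrow> nat list \<Rightarrow> nat list \<Rightarrow> bool" where
  "reflection_regular E l ns ms \<longleftrightarrow>
     (\<forall>x\<in>set ns. \<forall>y\<in>set ms. l x + l y \<notin> E \<and> - l x + l y \<notin> E)"

definition dual_reflection_regular ::
  "complex set \<Rightarrow> complex \<Rightarrow> (nat \<Rightarrow> complex) \<Rightarrow> nat list \<Rightarrow> nat list \<Rightarrow> bool" where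
  "dual_reflection_regular E \<rho> l ns ms \<longleftrightarrow>
     (\<forall>x\<in>set ns. \<forall>y\<in>set ms. - l x - l y - 2 * \<rho> \<notin> E \<and> l x - l y \<notin> E)"

definition reflection_family ::
  "complex set \<Rightarrow> (complex \<Rightarrow> complex^('v \<times> 'v)^('v::finite \<times> 'v)) \<Rightarrow> ('v, 'k) family \<Rightarrow> bool" where
  "reflection_family E R T \<longleftrightarrow>
     (\<forall>ns ms l. label_lists ns ms \<and> reflection_regular E l ns ms \<longrightarrow>
       (let X = set ns \<union> set ms in
        aux_eq X
          (aux_prod X
            [at_labels T l ns,
             cnum (fused_R X R (\<lambda>y x. l x + l y) ms ns),
             at_labels T l ms,
             cnum (fused_R X R (\<lambda>x y. - l x + l y) (rev ns) ms)])
          (aux_prod X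
            [cnum (fused_R X R (\<lambda>y x. - l x + l y) ms (rev ns)),
             at_labels T l ms,
             cnum (fused_R X R (\<lambda>x y. l x + l y) ns ms),
             at_labels T l ns])))"

definition dual_reflection_family ::
  "complex set \<Rightarrow> complex \<Rightarrow> complex^'v^'v \<Rightarrow> (complex \<Rightarrow> complex^('v \<times> 'v)^('v::finite \<times> 'v)) \<Rightarrow>
     ('v, 'k) family \<Rightarrow> bool" where
  "dual_reflection_family E \<rho> M R K \<longleftrightarrow>
     (\<forall>ns ms l. label_lists ns ms \<and> dual_reflection_regular E \<rho> l ns ms \<longrightarrow>
       (let X = set ns \<union> set ms in
        aux_eq X
          (aux_prod X
            [at_labels K l ns,
             cnum (fused1 X M ms),
             cnum (fused_R X R (\<lambda>y x. - l x - l y - 2 * \<rho>) (rev ms) (rev ns)),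
             cnum (fused1 X (matrix_inv M) ms),
             at_labels K l ms,
             cnum (fused_R X R (\<lambda>x y. l x - l y) ns (rev ms))])
          (aux_prod X
            [cnum (fused_R X R (\<lambda>y x. l x - l y) (rev ms) ns),
             at_labels K l ms,
             cnum (fused1 X (matrix_inv M) ms),
             cnum (fused_R X R (\<lambda>x y. - l x - l y - 2 * \<rho>) (rev ns) (rev ms)),
             cnum (fused1 X M ms),
             at_labels K l ns])))"

definition entries_in :: "'k operator set \<Rightarrow> ('v, 'k) family \<Rightarrow> bool" where
  "entries_in \<A> K \<longleftrightarrow> (\<forall>\<mu> i j. \<mu> \<noteq> [] \<and> length i = length \<mu> \<and> length j = length \<mu> \<longrightarrow> K \<mu> i j \<in> \<A>)"

definition entrywise :: "('k operator \<Rightarrow> 'l operator) \<Rightarrow> ('v, 'k) family \<Rightarrow> ('v, 'l) family" where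
  "entrywise t K \<mu> i j = t (K \<mu> i j)"

text \<open>\<open>Kst\<close> is the entrywise transposed family; the total quantum space is the tensor product
  of the space of \<open>T\<close> (left) and the space of \<open>Kst\<close> (right).\<close>

definition trace_operator ::
  "('v::finite, 'l) family \<Rightarrow> ('v, 'k) family \<Rightarrow> (nat \<Rightarrow> complex) \<Rightarrow> nat list \<Rightarrow> ('k \<times> 'l) operator" where
  "trace_operator Kst T l ns =
     aux_trace (set ns)
       (aux_mult (set ns) (at_labels (entrywise on_right Kst) l ns)
                          (at_labels (entrywise on_left T) l ns))"

end

theory Submission
  imports Defs
begin

text \<open>Write \<open>N\<close> and \<open>M\<close> for the two ordered label sets, \<open>\<K>\<close> for the matrices with entries \<open>K\<close>, and let \<open>*\<close>
  denote the quantum transposition of the entries of \<open>\<K>\<close>. The proof is Sklyanin's argument, carried out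
  with fused matrices.

  Entries of \<open>\<K>*\<close> and \<open>T\<close> commute, so \<open>H\<^sub>N H\<^sub>M\<close> is a single trace over all copies. A transposition in the
  copies of \<open>N\<close> under this trace makes the two \<open>\<K>*\<close> adjacent, and likewise the two \<open>T\<close>; between the two pairs
  one inserts \<open>A\<^sup>t C\<^sup>t = d\<close>, where \<open>t\<close> is the transposition in \<open>N\<close>, \<open>C\<close> is the fused matrix
  \<open>R(\<lambda>\<^sub>N + \<lambda>\<^sub>M)\<close> of the reflection equation and \<open>A\<close> is the conjugated fused matrix
  \<open>R(- \<lambda>\<^sub>N - \<lambda>\<^sub>M - 2\<rho>)\<close> of the dual equation. Since \<open>*\<close> reverses products, the result is
  \<open>d H\<^sub>N H\<^sub>M = Tr ((\<K>\<^sub>M A \<K>\<^sub>N)* (T\<^sub>N C T\<^sub>M))\<close>. This is the lemma \<open>trace_product\<close>, proved there by comparing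
  matrix entries; the relation for \<open>A\<close> and \<open>C\<close> is \<open>fused_crossing\<close>, which follows from crossing-unitarity.

  The two reflection equations say that \<open>T\<^sub>N C T\<^sub>M\<close> and \<open>\<K>\<^sub>M A \<K>\<^sub>N\<close> become the corresponding products with
  \<open>N\<close> and \<open>M\<close> exchanged when an outer fused matrix \<open>R(\<plusminus> (\<lambda>\<^sub>N - \<lambda>\<^sub>M))\<close> is moved from one side to the other. The
  outer matrices are inverse to each other up to a scalar by \<open>fused_unitarity\<close>, so they can be inserted and
  removed again under the trace (\<open>intertwine_trace\<close>). Applying \<open>trace_product\<close> with \<open>N\<close> and \<open>M\<close> exchanged then
  gives \<open>d H\<^sub>M H\<^sub>N\<close>. All scalars agree on both sides: the one from unitarity is an even function of its argument,
  and the one from crossing-unitarity depends only on the sums \<open>\<lambda>\<^sub>x + \<lambda>\<^sub>y\<close>.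

  Matrices on labelled copies are equal only up to \<open>aux_eq\<close>. For c-number matrices this congruence is turned into
  equality by the representation \<open>mat_op\<close> in an operator ring, where fused matrices are products of
  lists; partial transposition is not multiplicative, and \<open>ptr_mult\<close> and \<open>ptr_mult_rev\<close> say when it
  preserves or reverses a product.\<close>


section \<open>Operators on tensor products\<close>

lemma lookup_op_scale: "Poly_Mapping.lookup (apply_op (op_scale c a) v) k = c * Poly_Mapping.lookup (apply_op a v) k"
  by (simp add: op_scale.rep_eq)

lemma apply_op_add: "apply_op a (v + w) = apply_op a v + apply_op a w"
  using apply_op[of a] by (simp add: linear_vscale_iff)

lemma apply_op_vscale: "apply_op a (vscale c v) = vscale c (apply_op a v)"
  using apply_op[of a] by (simp add: linear_vscale_iff)

lemma apply_op_sum: "apply_op a (\<Sum>i\<in>I. f i) = (\<Sum>i\<in>I. apply_op a (f i))"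
proof -
  have "apply_op a 0 = 0" using apply_op_vscale[of a 0 0] by simp
  then show ?thesis by (induction I rule: infinite_finite_induct) (simp_all add: apply_op_add)
qed

lemma basis_expansion:
  "v = (\<Sum>i\<in>Poly_Mapping.keys v. vscale (Poly_Mapping.lookup v i) (Poly_Mapping.single i 1))"
proof (rule poly_mapping_eqI)
  fix k
  have "Poly_Mapping.lookup (\<Sum>i\<in>Poly_Mapping.keys v. vscale (Poly_Mapping.lookup v i) (Poly_Mapping.single i 1)) k
     = (\<Sum>i\<in>Poly_Mapping.keys v. if k = i then Poly_Mapping.lookup v i else 0)"
    unfolding lookup_sum by (rule sum.cong) (auto simp: lookup_single when_def)
  also have "\<dots> = Poly_Mapping.lookup v k" by (simp add: in_keys_iff)
  finally show "Poly_Mapping.lookup v k = Poly_Mapping.lookup (\<Sum>i\<in>Poly_Mapping.keys v. vscale (Poly_Mapping.lookup v i) (Poly_Mapping.single i 1)) k" ..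
qed

text \<open>Finitely supported vectors are finite combinations of basis vectors, so an operator is
  determined by its values on the basis even in infinite dimension.\<close>

lemma lookup_apply_op:
  "Poly_Mapping.lookup (apply_op a v) k =
    (\<Sum>i\<in>Poly_Mapping.keys v. Poly_Mapping.lookup v i * Poly_Mapping.lookup (apply_op a (Poly_Mapping.single i 1)) k)"
  by (subst basis_expansion[of v]) (simp add: apply_op_sum apply_op_vscale lookup_sum)

lemma operator_eqI:
  assumes "\<And>k. apply_op a (Poly_Mapping.single k 1) = apply_op b (Poly_Mapping.single k 1)"
  shows "a = b"
proof -
  have "apply_op a v = apply_op b v" for v
    by (rule poly_mapping_eqI) (simp add: lookup_apply_op[of _ v] assms)
  then show ?thesis by (simp add: apply_op_inject[symmetric] fun_eq_iff)
qed

lemma lookup_vec_tensor: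
  "Poly_Mapping.lookup (vec_tensor v w) p =
     Poly_Mapping.lookup v (fst p) * Poly_Mapping.lookup w (snd p)"
proof -
  have "Poly_Mapping.lookup (vec_tensor v w) p =
     (\<Sum>i\<in>Poly_Mapping.keys v. \<Sum>j\<in>Poly_Mapping.keys w.
        if i = fst p then if j = snd p then Poly_Mapping.lookup v i * Poly_Mapping.lookup w j else 0 else 0)"
    unfolding vec_tensor_def lookup_sum
    by (intro sum.cong) (auto simp: lookup_single when_def prod_eq_iff)
  also have "\<dots> = (\<Sum>i\<in>Poly_Mapping.keys v. if i = fst p then Poly_Mapping.lookup v i * Poly_Mapping.lookup w (snd p) else 0)"
    by (intro sum.cong) (auto simp: in_keys_iff)
  also have "\<dots> = Poly_Mapping.lookup v (fst p) * Poly_Mapping.lookup w (snd p)"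
    by (auto simp: in_keys_iff)
  finally show ?thesis .
qed

lemma lookup_apply_op_tensor:
  "Poly_Mapping.lookup (apply_op (op_tensor a b) v) p =
    (\<Sum>(i, j)\<in>Poly_Mapping.keys v. Poly_Mapping.lookup v (i, j) *
       (Poly_Mapping.lookup (apply_op a (Poly_Mapping.single i 1)) (fst p) *
        Poly_Mapping.lookup (apply_op b (Poly_Mapping.single j 1)) (snd p)))"
  by (simp add: op_tensor.rep_eq lookup_sum case_prod_unfold lookup_vec_tensor)

lemma apply_op_tensor:
  "apply_op (op_tensor a b) (vec_tensor v w) = vec_tensor (apply_op a v) (apply_op b w)"
proof (rule poly_mapping_eqI)
  fix p
  have k: "Poly_Mapping.keys (vec_tensor v w) = Poly_Mapping.keys v \<times> Poly_Mapping.keys w"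
    by (auto simp: in_keys_iff lookup_vec_tensor)
  show "Poly_Mapping.lookup (apply_op (op_tensor a b) (vec_tensor v w)) p =
        Poly_Mapping.lookup (vec_tensor (apply_op a v) (apply_op b w)) p"
    unfolding lookup_apply_op_tensor lookup_vec_tensor k
      lookup_apply_op[of a v] lookup_apply_op[of b w] sum_product sum.cartesian_product
    by (rule sum.cong) (auto simp: lookup_vec_tensor)
qed

lemma single_eq_vec_tensor:
  "Poly_Mapping.single p 1 = vec_tensor (Poly_Mapping.single (fst p) 1) (Poly_Mapping.single (snd p) 1)"
  by (rule poly_mapping_eqI) (auto simp: lookup_vec_tensor lookup_single when_def prod_eq_iff)

lemma apply_op_times: "apply_op (a * b) v = apply_op a (apply_op b v)"
  by (simp add: times_operator.rep_eq)

lemma apply_op_tensor_single: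
  "apply_op (op_tensor a b) (Poly_Mapping.single p 1) =
    vec_tensor (apply_op a (Poly_Mapping.single (fst p) 1)) (apply_op b (Poly_Mapping.single (snd p) 1))"
  unfolding single_eq_vec_tensor[of p] apply_op_tensor ..

text \<open>Multiplicativity is what makes the operators on the two tensor factors two commuting copies
  of their algebras: both orders of \<open>on_left a\<close> and \<open>on_right b\<close> give \<open>op_tensor a b\<close>.\<close>

lemma op_tensor_mult: "op_tensor a b * op_tensor a' b' = op_tensor (a * a') (b * b')"
  by (rule operator_eqI) (simp add: apply_op_times apply_op_tensor_single apply_op_tensor)

lemma op_tensor_add_left: "op_tensor (a + a') b = op_tensor a b + op_tensor a' b"
  by (rule operator_eqI, rule poly_mapping_eqI)
    (simp add: apply_op_tensor_single plus_operator.rep_eq lookup_vec_tensor lookup_add algebra_simps)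

lemma op_tensor_add_right: "op_tensor a (b + b') = op_tensor a b + op_tensor a b'"
  by (rule operator_eqI, rule poly_mapping_eqI)
    (simp add: apply_op_tensor_single plus_operator.rep_eq lookup_vec_tensor lookup_add algebra_simps)

text \<open>Working with central ring elements instead of \<open>op_scale\<close> leaves a single product to
  calculate with, and scalars can be moved by commutation.\<close>

definition scal :: "complex \<Rightarrow> 'k operator" where
  "scal c = op_scale c 1"

lemma op_scale_conv: "op_scale c a = scal c * a"
  unfolding scal_def by transfer simp

lemma scal_commute: "a * scal c = scal c * a"
  unfolding scal_def by transfer (simp add: linear_vscale_iff)

lemma scal_mult: "scal (c * d) = scal c * scal d"
  unfolding scal_def by transfer simp

lemma scal_add: "scal (c + d) = scal c + scal d"
  unfolding scal_def by transfer (simp add: fsv.scale_left_distrib fun_eq_iff)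

lemma scal_0 [simp]: "scal 0 = 0"
  unfolding scal_def by transfer simp

lemma scal_1 [simp]: "scal 1 = 1"
  unfolding scal_def by transfer simp

lemma scal_sum: "scal (\<Sum>i\<in>I. f i) = (\<Sum>i\<in>I. scal (f i))"
  by (induction I rule: infinite_finite_induct) (simp_all add: scal_add)

lemma scal_cancel: "scal c * a = scal c * b \<Longrightarrow> c \<noteq> 0 \<Longrightarrow> a = b"
  by (metis scal_mult mult.assoc left_inverse scal_1 mult_1)

lemma op_tensor_scal: "op_tensor (scal c) 1 = scal c" "op_tensor 1 (scal c) = scal c"
  by (rule operator_eqI, rule poly_mapping_eqI,
    simp add: apply_op_tensor_single scal_def lookup_op_scale lookup_vec_tensor one_operator.rep_eq lookup_single when_def prod_eq_iff)+

lemma on_left_hom: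
  "on_left (a + b) = on_left a + on_left b" "on_left (a * b) = on_left a * on_left b"
  "on_left (scal c) = scal c"
  by (simp_all add: on_left_def op_tensor_add_left op_tensor_mult op_tensor_scal)

lemma on_right_hom:
  "on_right (a + b) = on_right a + on_right b" "on_right (a * b) = on_right a * on_right b"
  "on_right (scal c) = scal c"
  by (simp_all add: on_right_def op_tensor_add_right op_tensor_mult op_tensor_scal)

lemma on_left_right_commute: "on_left a * on_right b = on_right b * on_left a"
  by (simp add: on_left_def on_right_def op_tensor_mult)


section \<open>Partial transposition\<close>

lemma finite_confs [simp]: "finite X \<Longrightarrow> finite (confs X :: (nat \<Rightarrow> 'v::finite) set)"
  by (simp add: finite_PiE)

lemma confs_upd [simp]: "s \<in> confs X \<Longrightarrow> x \<in> X \<Longrightarrow> s(x := v) \<in> confs X"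
  by (auto simp: PiE_def extensional_def)

lemma confs_override [simp]: "s \<in> confs X \<Longrightarrow> u \<in> confs X \<Longrightarrow> override_on s u N \<in> confs X"
  by (auto simp: PiE_def extensional_def override_on_def)

lemma aux_eq_refl [simp]: "aux_eq X A A"
  by (simp add: aux_eq_def)

lemma aux_eq_sym: "aux_eq X A B \<Longrightarrow> aux_eq X B A"
  by (simp add: aux_eq_def)

lemma aux_eq_trans [trans]: "aux_eq X A B \<Longrightarrow> aux_eq X B C \<Longrightarrow> aux_eq X A C"
  by (simp add: aux_eq_def)

lemma aux_eq_mult: "aux_eq X A A' \<Longrightarrow> aux_eq X B B' \<Longrightarrow> aux_eq X (aux_mult X A B) (aux_mult X A' B')"
  by (simp add: aux_eq_def aux_mult_def)

lemma aux_mult_assoc: "aux_mult X (aux_mult X A B) C = aux_mult X A (aux_mult X B C)"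
  by (rule ext, rule ext)
    (simp add: aux_mult_def sum_distrib_left sum_distrib_right mult.assoc, rule sum.swap)

lemma aux_mult_one_right:
  "finite X \<Longrightarrow> aux_eq X (aux_mult X A aux_one) A"
  by (simp add: aux_eq_def aux_mult_def aux_one_def if_distrib sum.delta cong: if_cong)

lemma aux_mult_one_left:
  "finite X \<Longrightarrow> aux_eq X (aux_mult X aux_one A) A"
  by (simp add: aux_eq_def aux_mult_def aux_one_def if_distrib if_distribR sum.delta sum.delta' cong: if_cong)

text \<open>Transposition in all copies labelled by \<open>N\<close> at once: the row and column configurations
  exchange their restrictions to \<open>N\<close>.\<close>

definition ptr :: "nat set \<Rightarrow> ('v, 'a) aux \<Rightarrow> ('v, 'a) aux" where
  "ptr N A s u = A (override_on s u N) (override_on u s N)"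

text \<open>The matrix acts as the identity on the copy labelled \<open>x\<close>. Stating locality one label at a
  time lets partial transpositions be handled by induction on the set of labels.\<close>

definition trivial_at :: "nat set \<Rightarrow> nat \<Rightarrow> ('v, 'a::zero) aux \<Rightarrow> bool" where
  "trivial_at X x A \<longleftrightarrow> (\<forall>s\<in>confs X. \<forall>u\<in>confs X.
     (s x \<noteq> u x \<longrightarrow> A s u = 0) \<and> (s x = u x \<longrightarrow> (\<forall>v. A (s(x := v)) (u(x := v)) = A s u)))"

lemma trivial_at_zero: "trivial_at X x A \<Longrightarrow> s \<in> confs X \<Longrightarrow> u \<in> confs X \<Longrightarrow> s x \<noteq> u x \<Longrightarrow> A s u = 0"
  by (simp add: trivial_at_def)

lemma trivial_at_shift:
  "trivial_at X x A \<Longrightarrow> s \<in> confs X \<Longrightarrow> u \<in> confs X \<Longrightarrow> s x = u x \<Longrightarrow> A (s(x := v)) (u(x := v)) = A s u"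
  by (simp add: trivial_at_def)

lemma ptr_empty [simp]: "ptr {} A = A"
  by (simp add: ptr_def fun_eq_iff)

lemma ptr_insert: "x \<notin> N \<Longrightarrow> ptr (insert x N) A = ptrans x (ptr N A)"
proof (rule ext, rule ext)
  fix s u assume "x \<notin> N"
  then have "override_on s u (insert x N) = override_on (s(x := u x)) (u(x := s x)) N" for s u :: "nat \<Rightarrow> 'a"
    by (auto simp: override_on_def)
  then show "ptr (insert x N) A s u = ptrans x (ptr N A) s u"
    by (simp add: ptr_def ptrans_def)
qed

lemma ptr_single: "ptr {x} A = ptrans x A"
  using ptr_insert[of x "{}" A] by simp

lemma ptr_cong: "aux_eq X A B \<Longrightarrow> aux_eq X (ptr N A) (ptr N B)"
  by (simp add: aux_eq_def ptr_def)

lemma ptrans_cong: "aux_eq X A B \<Longrightarrow> aux_eq X (ptrans x A) (ptrans x B)"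
  using ptr_cong[of X A B "{x}"] by (simp add: ptr_single)

lemma trivial_at_ptr:
  assumes "trivial_at X x A" shows "trivial_at X x (ptr N A)"
proof -
  have "override_on (s(x := v)) (u(x := v)) N = (override_on s u N)(x := v)" for s u :: "nat \<Rightarrow> 'a" and v
    by (auto simp: override_on_def)
  moreover have "override_on s u N x = override_on u s N x \<longleftrightarrow> s x = u x" for s u :: "nat \<Rightarrow> 'a"
    by (auto simp: override_on_def)
  ultimately show ?thesis
    using assms by (simp add: trivial_at_def ptr_def)
qed

lemma sum_trivial_left:
  fixes A :: "('v::finite, 'a::ring_1) aux"
  assumes "finite X" "trivial_at X x A" "s \<in> confs X"
  shows "(\<Sum>r\<in>confs X. A s r * g r) = (\<Sum>r\<in>{r \<in> confs X. r x = s x}. A s r * g r)"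
proof (rule sum.mono_neutral_right)
  show "\<forall>r\<in>confs X - {r \<in> confs X. r x = s x}. A s r * g r = 0"
    proof
    fix r assume "r \<in> confs X - {r \<in> confs X. r x = s x}"
    then show "A s r * g r = 0" using trivial_at_zero[OF assms(2,3), of r] by auto
  qed
qed (use assms in auto)

lemma sum_trivial_right:
  fixes B :: "('v::finite, 'a::ring_1) aux"
  assumes "finite X" "trivial_at X x B" "u \<in> confs X"
  shows "(\<Sum>r\<in>confs X. g r * B r u) = (\<Sum>r\<in>{r \<in> confs X. r x = u x}. g r * B r u)"
proof (rule sum.mono_neutral_right)
  show "\<forall>r\<in>confs X - {r \<in> confs X. r x = u x}. g r * B r u = 0"
    proof
    fix r assume "r \<in> confs X - {r \<in> confs X. r x = u x}"
    then show "g r * B r u = 0" using trivial_at_zero[OF assms(2) _ assms(3), of r] by auto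
  qed
qed (use assms in auto)

text \<open>Both sides are sums over intermediate configurations \<open>r\<close> whose value at \<open>x\<close> is forced, to
  \<open>u x\<close> on the left and to \<open>s x\<close> on the right, because \<open>A\<close> is the identity there; resetting that
  one value matches the sums term by term.\<close>

lemma ptrans_mult_left:
  fixes A :: "('v::finite, 'a::ring_1) aux"
  assumes X: "finite X" "x \<in> X" and A: "trivial_at X x A"
  shows "aux_eq X (ptrans x (aux_mult X A B)) (aux_mult X A (ptrans x B))"
  unfolding aux_eq_def
proof (intro ballI)
  fix s u :: "nat \<Rightarrow> 'v" assume su: "s \<in> confs X" "u \<in> confs X"
  have "ptrans x (aux_mult X A B) s u
      = (\<Sum>r\<in>confs X. A (s(x := u x)) r * B r (u(x := s x)))"
    by (simp add: ptrans_def aux_mult_def)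
  also have "\<dots> = (\<Sum>r\<in>{r \<in> confs X. r x = u x}. A (s(x := u x)) r * B r (u(x := s x)))"
    by (subst sum_trivial_left[OF X(1) A]) (use su X in simp_all)
  also have "\<dots> = (\<Sum>r\<in>{r \<in> confs X. r x = s x}. A s r * B (r(x := u x)) (u(x := r x)))"
  proof (rule sum.reindex_bij_witness[of _ "\<lambda>r. r(x := u x)" "\<lambda>r. r(x := s x)"])
    fix r assume r: "r \<in> {r \<in> confs X. r x = u x}"
    have "A (s(x := u x)) ((r(x := s x))(x := u x)) = A s (r(x := s x))"
      by (rule trivial_at_shift[OF A]) (use su r X in auto)
    then show "A s (r(x := s x)) * B ((r(x := s x))(x := u x)) (u(x := (r(x := s x)) x))
        = A (s(x := u x)) r * B r (u(x := s x))"
      using r by (simp add: fun_upd_idem)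
  qed (use su X in \<open>auto simp: fun_upd_idem\<close>)
  also have "\<dots> = (\<Sum>r\<in>confs X. A s r * B (r(x := u x)) (u(x := r x)))"
    by (subst sum_trivial_left[OF X(1) A]) (use su X in simp_all)
  finally show "ptrans x (aux_mult X A B) s u = aux_mult X A (ptrans x B) s u"
    by (simp add: ptrans_def aux_mult_def)
qed

lemma ptrans_mult_right:
  fixes A :: "('v::finite, 'a::ring_1) aux"
  assumes X: "finite X" "x \<in> X" and B: "trivial_at X x B"
  shows "aux_eq X (ptrans x (aux_mult X A B)) (aux_mult X (ptrans x A) B)"
  unfolding aux_eq_def
proof (intro ballI)
  fix s u :: "nat \<Rightarrow> 'v" assume su: "s \<in> confs X" "u \<in> confs X"
  have "ptrans x (aux_mult X A B) s u
      = (\<Sum>r\<in>confs X. A (s(x := u x)) r * B r (u(x := s x)))"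
    by (simp add: ptrans_def aux_mult_def)
  also have "\<dots> = (\<Sum>r\<in>{r \<in> confs X. r x = s x}. A (s(x := u x)) r * B r (u(x := s x)))"
    by (subst sum_trivial_right[OF X(1) B]) (use su X in simp_all)
  also have "\<dots> = (\<Sum>r\<in>{r \<in> confs X. r x = u x}. A (s(x := r x)) (r(x := s x)) * B r u)"
  proof (rule sum.reindex_bij_witness[of _ "\<lambda>r. r(x := s x)" "\<lambda>r. r(x := u x)"])
    fix r assume r: "r \<in> {r \<in> confs X. r x = s x}"
    have "B ((r(x := u x))(x := s x)) (u(x := s x)) = B (r(x := u x)) u"
      by (rule trivial_at_shift[OF B]) (use su r X in auto)
    then show "A (s(x := (r(x := u x)) x)) ((r(x := u x))(x := s x)) * B (r(x := u x)) u
        = A (s(x := u x)) r * B r (u(x := s x))"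
      using r by (simp add: fun_upd_idem)
  qed (use su X in \<open>auto simp: fun_upd_idem\<close>)
  also have "\<dots> = (\<Sum>r\<in>confs X. A (s(x := r x)) (r(x := s x)) * B r u)"
    by (subst sum_trivial_right[OF X(1) B]) (use su X in simp_all)
  finally show "ptrans x (aux_mult X A B) s u = aux_mult X (ptrans x A) B s u"
    by (simp add: ptrans_def aux_mult_def)
qed

lemma ptrans_trivial:
  assumes X: "x \<in> X" and A: "trivial_at X x A"
  shows "aux_eq X (ptrans x A) A"
  unfolding aux_eq_def
proof (intro ballI)
  fix s u :: "nat \<Rightarrow> 'a" assume su: "s \<in> confs X" "u \<in> confs X"
  show "ptrans x A s u = A s u"
  proof (cases "s x = u x")
    case True then show ?thesis by (simp add: ptrans_def fun_upd_idem)
  next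
    case False
    have "A (s(x := u x)) (u(x := s x)) = 0"
      by (rule trivial_at_zero[OF A]) (use su X False in auto)
    then show ?thesis using False trivial_at_zero[OF A su False] by (simp add: ptrans_def)
  qed
qed

lemma ptr_trivial:
  assumes "finite N" "N \<subseteq> X" "\<And>x. x \<in> N \<Longrightarrow> trivial_at X x A"
  shows "aux_eq X (ptr N A) A"
  using assms
proof (induction N)
  case (insert x N)
  have "aux_eq X (ptrans x (ptr N A)) (ptr N A)"
    by (intro ptrans_trivial trivial_at_ptr) (use insert in auto)
  then show ?case
    using insert by (simp add: ptr_insert) (blast intro: aux_eq_trans)
qed simp

text \<open>At a label where one of the factors is the identity, only the other factor is
  transposed, and no reordering occurs.\<close>

lemma ptr_mult:
  fixes A :: "('v::finite, 'a::ring_1) aux"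
  assumes "finite X" "N \<subseteq> X" "\<And>x. x \<in> N \<Longrightarrow> trivial_at X x A \<or> trivial_at X x B"
  shows "aux_eq X (ptr N (aux_mult X A B)) (aux_mult X (ptr N A) (ptr N B))"
proof -
  have "finite N" using assms finite_subset by blast
  then show ?thesis using assms(2,3)
  proof (induction N)
    case (insert x N)
    have "aux_eq X (ptrans x (ptr N (aux_mult X A B))) (ptrans x (aux_mult X (ptr N A) (ptr N B)))"
      using insert by (intro ptrans_cong) auto
    also have "aux_eq X \<dots> (aux_mult X (ptrans x (ptr N A)) (ptrans x (ptr N B)))"
    proof -
      have "trivial_at X x A \<or> trivial_at X x B" using insert.prems by simp
      then show ?thesis
      proof
      assume "trivial_at X x A"
      then have t: "trivial_at X x (ptr N A)" by (rule trivial_at_ptr)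
      have x: "x \<in> X" using insert.prems by auto
      show ?thesis
        using ptrans_mult_left[OF assms(1) x t, of "ptr N B"]
          aux_eq_mult[OF aux_eq_sym[OF ptrans_trivial[OF x t]] aux_eq_refl]
        by (rule aux_eq_trans)
    next
      assume "trivial_at X x B"
      then have t: "trivial_at X x (ptr N B)" by (rule trivial_at_ptr)
      have x: "x \<in> X" using insert.prems by auto
      show ?thesis
        using ptrans_mult_right[OF assms(1) x t, of "ptr N A"]
          aux_eq_mult[OF aux_eq_refl aux_eq_sym[OF ptrans_trivial[OF x t]]]
        by (rule aux_eq_trans)
      qed
    qed
    finally show ?case using insert by (simp add: ptr_insert)
  qed simp
qed

lemma ptr_full: "s \<in> confs X \<Longrightarrow> u \<in> confs X \<Longrightarrow> ptr X A s u = A u s"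
proof -
  assume su: "s \<in> confs X" "u \<in> confs X"
  have "override_on s u X = u" "override_on u s X = s"
    using su by (auto simp: override_on_def PiE_def extensional_def fun_eq_iff)
  then show ?thesis by (simp add: ptr_def)
qed

lemma ptr_full_mult:
  fixes A :: "('v::finite, 'a::comm_ring_1) aux"
  shows "aux_eq X (ptr X (aux_mult X A B)) (aux_mult X (ptr X B) (ptr X A))"
  by (simp add: aux_eq_def aux_mult_def ptr_full mult.commute)

text \<open>Transposition in \<open>N\<close> is the full transposition, which reverses products, composed with
  the transposition in the complementary labels, which preserves the order by the previous rule.\<close>

lemma ptr_mult_rev:
  fixes A :: "('v::finite, 'a::comm_ring_1) aux"
  assumes "finite X" "N \<subseteq> X" "\<And>x. x \<in> X - N \<Longrightarrow> trivial_at X x A \<or> trivial_at X x B"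
  shows "aux_eq X (ptr N (aux_mult X A B)) (aux_mult X (ptr N B) (ptr N A))"
proof -
  have full: "aux_eq X (ptr X (ptr (X - N) C)) (ptr N C)" for C :: "('v, 'a) aux"
  proof -
    have "override_on (override_on s u X) (override_on u s X) (X - N) = override_on s u N"
      for s u :: "nat \<Rightarrow> 'v"
      using assms(2) by (auto simp: override_on_def fun_eq_iff)
    then have "ptr X (ptr (X - N) C) s u = ptr N C s u" for s u
      unfolding ptr_def by metis
    then have "ptr X (ptr (X - N) C) = ptr N C"
      by blast
    then show ?thesis by simp
  qed
  have "aux_eq X (ptr N (aux_mult X A B)) (ptr X (ptr (X - N) (aux_mult X A B)))"
    by (rule aux_eq_sym[OF full])
  also have "aux_eq X \<dots> (ptr X (aux_mult X (ptr (X - N) A) (ptr (X - N) B)))"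
    by (intro ptr_cong ptr_mult) (use assms in auto)
  also have "aux_eq X \<dots> (aux_mult X (ptr X (ptr (X - N) B)) (ptr X (ptr (X - N) A)))"
    by (rule ptr_full_mult)
  also have "aux_eq X \<dots> (aux_mult X (ptr N B) (ptr N A))"
    by (intro aux_eq_mult full)
  finally show ?thesis .
qed

text \<open>The case \<open>N = {}\<close> of the reversal rule: matrices acting on disjoint sets of copies commute.\<close>

lemma disjoint_commute:
  fixes A :: "('v::finite, 'a::comm_ring_1) aux"
  assumes "finite X" "\<And>x. x \<in> X \<Longrightarrow> trivial_at X x A \<or> trivial_at X x B"
  shows "aux_eq X (aux_mult X A B) (aux_mult X B A)"
  using ptr_mult_rev[of X "{}" A B] assms by simp

lemma trivial_at_one: "trivial_at X x aux_one"
  by (auto simp: trivial_at_def aux_one_def fun_eq_iff)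

lemma trivial_at_mult:
  fixes A :: "('v::finite, 'a::ring_1) aux"
  assumes X: "finite X" "x \<in> X" and A: "trivial_at X x A" and B: "trivial_at X x B"
  shows "trivial_at X x (aux_mult X A B)"
  unfolding trivial_at_def
proof (intro ballI conjI impI allI)
  fix s u :: "nat \<Rightarrow> 'v" assume su: "s \<in> confs X" "u \<in> confs X" and "s x \<noteq> u x"
  then have "A s r * B r u = 0" if "r \<in> confs X" for r
    using that trivial_at_zero[OF A su(1) that] trivial_at_zero[OF B that su(2)] by (cases "s x = r x") auto
  then show "aux_mult X A B s u = 0" by (simp add: aux_mult_def)
next
  fix s u :: "nat \<Rightarrow> 'v" and v assume su: "s \<in> confs X" "u \<in> confs X" and eq: "s x = u x"
  have "(\<Sum>r\<in>confs X. A (s(x := v)) r * B r (u(x := v)))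
      = (\<Sum>r\<in>{r \<in> confs X. r x = v}. A (s(x := v)) r * B r (u(x := v)))"
    by (subst sum_trivial_left[OF X(1) A]) (use su X in simp_all)
  also have "\<dots> = (\<Sum>r\<in>{r \<in> confs X. r x = s x}. A s r * B r u)"
  proof (rule sum.reindex_bij_witness[of _ "\<lambda>r. r(x := v)" "\<lambda>r. r(x := s x)"])
    fix r assume r: "r \<in> {r \<in> confs X. r x = v}"
    have "A (s(x := v)) ((r(x := s x))(x := v)) = A s (r(x := s x))"
      by (rule trivial_at_shift[OF A]) (use su r X in auto)
    moreover have "B ((r(x := s x))(x := v)) (u(x := v)) = B (r(x := s x)) u"
      by (rule trivial_at_shift[OF B]) (use su r X eq in auto)
    ultimately show "A s (r(x := s x)) * B (r(x := s x)) u = A (s(x := v)) r * B r (u(x := v))"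
      using r by (simp add: fun_upd_idem)
  qed (use su X in \<open>auto simp: fun_upd_idem\<close>)
  also have "\<dots> = (\<Sum>r\<in>confs X. A s r * B r u)"
    by (subst sum_trivial_left[OF X(1) A]) (use su X in simp_all)
  finally show "aux_mult X A B (s(x := v)) (u(x := v)) = aux_mult X A B s u"
    by (simp add: aux_mult_def)
qed

lemma trivial_at_prod:
  fixes As :: "('v::finite, 'a::ring_1) aux list"
  assumes "finite X" "x \<in> X" "\<And>A. A \<in> set As \<Longrightarrow> trivial_at X x A"
  shows "trivial_at X x (aux_prod X As)"
  using assms(3)
proof (induction As)
  case Nil
  then show ?case by (simp add: aux_prod_def trivial_at_one)
next
  case (Cons A As)
  then have "trivial_at X x A" "trivial_at X x (aux_prod X As)" by simp_all
  from trivial_at_mult[OF assms(1,2) this] show ?case by (simp add: aux_prod_def)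
qed


section \<open>Representation of matrices by operators\<close>

text \<open>A faithful representation of c-number matrices modulo \<open>aux_eq X\<close>. Congruences of matrices
  become equations in a ring, for which \<open>prod_list\<close> and associativity are available. Basis
  vectors outside \<open>confs X\<close> are fixed, so that the unit matrix is sent to \<open>1\<close>.\<close>

lift_definition mat_op :: "nat set \<Rightarrow> ('v::finite, complex) aux \<Rightarrow> (nat \<Rightarrow> 'v) operator" is
  "\<lambda>X A v. Abs_poly_mapping (\<lambda>s. if s \<in> confs X
      then \<Sum>r\<in>confs X. A s r * Poly_Mapping.lookup v r else Poly_Mapping.lookup v s)"
proof -
  fix X and A :: "('v, complex) aux"
  define F where "F v = (\<lambda>s. if s \<in> confs X
      then \<Sum>r\<in>confs X. A s r * Poly_Mapping.lookup v r else Poly_Mapping.lookup v s)"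
    for v :: "(nat \<Rightarrow> 'v) \<Rightarrow>\<^sub>0 complex"
  have fin: "finite {s. F v s \<noteq> 0}" for v
  proof (cases "finite (confs X :: (nat \<Rightarrow> 'v) set)")
    case True
    have "{s. F v s \<noteq> 0} \<subseteq> confs X \<union> Poly_Mapping.keys v"
      by (auto simp: F_def in_keys_iff)
    then show ?thesis using True by (meson finite_UnI finite_keys finite_subset)
  next
    case False
    then have "{s. F v s \<noteq> 0} \<subseteq> Poly_Mapping.keys v"
      by (auto simp: F_def in_keys_iff)
    then show ?thesis by (meson finite_keys finite_subset)
  qed
  have "Vector_Spaces.linear vscale vscale (\<lambda>v. Abs_poly_mapping (F v))"
    unfolding linear_vscale_iff
    by (intro conjI allI; rule poly_mapping_eqI)
      (auto simp: Abs_poly_mapping_inverse fin lookup_add,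
        auto simp: F_def lookup_add algebra_simps sum.distrib sum_distrib_left)
  then show "Vector_Spaces.linear vscale vscale (\<lambda>v. Abs_poly_mapping (\<lambda>s. if s \<in> confs X
      then \<Sum>r\<in>confs X. A s r * Poly_Mapping.lookup v r else Poly_Mapping.lookup v s))"
    by (simp add: F_def[abs_def])
qed

lemma lookup_mat_op:
  assumes "finite X"
  shows "Poly_Mapping.lookup (apply_op (mat_op X A) v) s = (if s \<in> confs X
      then \<Sum>r\<in>confs X. A s r * Poly_Mapping.lookup v r else Poly_Mapping.lookup v s)"
proof -
  have "{s. (if s \<in> confs X then \<Sum>r\<in>confs X. A s r * Poly_Mapping.lookup v r
       else Poly_Mapping.lookup v s) \<noteq> 0} \<subseteq> confs X \<union> Poly_Mapping.keys v"
    by (auto simp: in_keys_iff)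
  then have "finite {s. (if s \<in> confs X then \<Sum>r\<in>confs X. A s r * Poly_Mapping.lookup v r
       else Poly_Mapping.lookup v s) \<noteq> 0}"
    by (rule finite_subset) (simp add: assms)
  then show ?thesis by (simp add: mat_op.rep_eq Abs_poly_mapping_inverse)
qed

lemma mat_op_mult:
  assumes X: "finite X" shows "mat_op X (aux_mult X A B) = mat_op X A * mat_op X B"
proof (rule operator_eqI, rule poly_mapping_eqI)
  fix k s :: "nat \<Rightarrow> 'a"
  let ?e = "Poly_Mapping.lookup (Poly_Mapping.single k 1 :: (nat \<Rightarrow> 'a) \<Rightarrow>\<^sub>0 complex)"
  let ?L = "Poly_Mapping.lookup (apply_op (mat_op X (aux_mult X A B)) (Poly_Mapping.single k 1)) s"
  let ?R = "Poly_Mapping.lookup (apply_op (mat_op X A * mat_op X B) (Poly_Mapping.single k 1)) s"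
  show "?L = ?R"
  proof (cases "s \<in> confs X")
    case True
    have "?L = (\<Sum>r\<in>confs X. (\<Sum>q\<in>confs X. A s q * B q r) * ?e r)"
      using True by (simp only: lookup_mat_op[OF X] aux_mult_def if_True)
    also have "\<dots> = (\<Sum>r\<in>confs X. \<Sum>q\<in>confs X. A s q * (B q r * ?e r))"
      by (simp only: sum_distrib_right mult.assoc)
    also have "\<dots> = (\<Sum>q\<in>confs X. A s q * (\<Sum>r\<in>confs X. B q r * ?e r))"
      by (subst sum.swap) (simp only: sum_distrib_left)
    also have "\<dots> = ?R"
      using True by (simp only: apply_op_times lookup_mat_op[OF X] if_True cong: sum.cong)
    finally show ?thesis .
  qed (simp add: apply_op_times lookup_mat_op[OF X])
qed

lemma mat_op_eq_iff:
  assumes X: "finite X" shows "mat_op X A = mat_op X B \<longleftrightarrow> aux_eq X A B"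
proof
  assume eq: "mat_op X A = mat_op X B"
  show "aux_eq X A B"
    unfolding aux_eq_def
  proof (intro ballI)
    fix s u :: "nat \<Rightarrow> 'a" assume su: "s \<in> confs X" "u \<in> confs X"
    have "Poly_Mapping.lookup (apply_op (mat_op X C) (Poly_Mapping.single u 1)) s = C s u" for C
    proof -
      have "Poly_Mapping.lookup (apply_op (mat_op X C) (Poly_Mapping.single u 1)) s
          = (\<Sum>r\<in>confs X. if u = r then C s r else 0)"
        using su by (auto simp: lookup_mat_op[OF X] lookup_single when_def intro!: sum.cong)
      then show ?thesis using su X by (simp add: sum.delta')
    qed
    then show "A s u = B s u" using eq by metis
  qed
next
  assume "aux_eq X A B"
  then show "mat_op X A = mat_op X B"
    by (intro operator_eqI poly_mapping_eqI) (simp add: lookup_mat_op[OF X] aux_eq_def)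
qed

lemma mat_op_one: "finite X \<Longrightarrow> mat_op X aux_one = 1"
  by (intro operator_eqI poly_mapping_eqI)
    (simp add: lookup_mat_op aux_one_def one_operator.rep_eq mult_delta_left)

lemma mat_op_prod: "finite X \<Longrightarrow> mat_op X (aux_prod X As) = prod_list (map (mat_op X) As)"
  by (induction As) (auto simp: aux_prod_def mat_op_one mat_op_mult)


section \<open>Matrices on two labels\<close>

definition pair12 :: "'v \<Rightarrow> 'v \<Rightarrow> nat \<Rightarrow> 'v" where
  "pair12 a b = (\<lambda>_. undefined)(1 := a, 2 := b)"

text \<open>The hypotheses on \<open>R\<close> speak about the labels 1 and 2. Replacing these by two labels
  \<open>x\<close> and \<open>y\<close> of \<open>X\<close> is a multiplicative embedding compatible with partial transposition, so
  every relation between matrices on \<open>{1, 2}\<close> holds on any two copies.\<close>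

definition emb :: "nat \<Rightarrow> nat \<Rightarrow> ('v, 'a::zero) aux \<Rightarrow> ('v, 'a) aux" where
  "emb x y A s u = (if \<forall>z. z \<notin> {x, y} \<longrightarrow> s z = u z
     then A (pair12 (s x) (s y)) (pair12 (u x) (u y)) else 0)"

lemma pair12_confs [simp]: "pair12 a b \<in> confs {1, 2}"
  by (auto simp: pair12_def PiE_def extensional_def)

lemma pair12_app [simp]: "pair12 a b 1 = a" "pair12 a b (Suc 0) = a" "pair12 a b 2 = b"
  by (simp_all add: pair12_def)

lemma pair12_other: "z \<noteq> 1 \<Longrightarrow> z \<noteq> 2 \<Longrightarrow> pair12 a b z = undefined"
  by (simp add: pair12_def)

lemma pair12_eta: "w \<in> confs {1, 2} \<Longrightarrow> pair12 (w 1) (w 2) = w"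
  by (auto simp: pair12_def PiE_def extensional_def fun_eq_iff)

lemma pair12_inject: "pair12 a b = pair12 c d \<longleftrightarrow> a = c \<and> b = d"
  by (metis pair12_app(1,3))

lemma emb_mult:
  fixes A :: "('v::finite, 'a::ring_1) aux"
  assumes X: "finite X" "x \<in> X" "y \<in> X" "x \<noteq> y"
  shows "aux_eq X (aux_mult X (emb x y A) (emb x y B)) (emb x y (aux_mult {1, 2} A B))"
  unfolding aux_eq_def
proof (intro ballI)
  fix s u :: "nat \<Rightarrow> 'v" assume su: "s \<in> confs X" "u \<in> confs X"
  show "aux_mult X (emb x y A) (emb x y B) s u = emb x y (aux_mult {1, 2} A B) s u"
  proof (cases "\<forall>z. z \<notin> {x, y} \<longrightarrow> s z = u z")
    case False
    then have "emb x y A s r * emb x y B r u = 0" for r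
      by (auto simp: emb_def)
    then have "aux_mult X (emb x y A) (emb x y B) s u = 0" by (simp add: aux_mult_def)
    then show ?thesis using False by (simp only: emb_def if_False)
  next
    case True
    define S where "S = {r \<in> confs X. \<forall>z. z \<notin> {x, y} \<longrightarrow> s z = r z}"
    have "aux_mult X (emb x y A) (emb x y B) s u = (\<Sum>r\<in>S. emb x y A s r * emb x y B r u)"
      unfolding aux_mult_def using X(1) by (intro sum.mono_neutral_right) (auto simp: S_def emb_def)
    also have "\<dots> = (\<Sum>w\<in>confs {1, 2}. A (pair12 (s x) (s y)) w * B w (pair12 (u x) (u y)))"
    proof (rule sum.reindex_bij_witness[of _ "\<lambda>w. s(x := w 1, y := w 2)" "\<lambda>r. pair12 (r x) (r y)"])
      fix r assume r: "r \<in> S"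
      then show "s(x := pair12 (r x) (r y) 1, y := pair12 (r x) (r y) 2) = r"
        by (auto simp: S_def fun_eq_iff)
      show "pair12 (r x) (r y) \<in> confs {1, 2}" by (rule pair12_confs)
      have "\<forall>z. z \<notin> {x, y} \<longrightarrow> s z = r z" using r by (simp add: S_def)
      moreover have "\<forall>z. z \<notin> {x, y} \<longrightarrow> r z = u z" using True calculation by metis
      ultimately show "A (pair12 (s x) (s y)) (pair12 (r x) (r y)) * B (pair12 (r x) (r y)) (pair12 (u x) (u y))
          = emb x y A s r * emb x y B r u"
        unfolding emb_def by simp
    next
      fix w :: "nat \<Rightarrow> 'v" assume w: "w \<in> confs {1, 2}"
      show "pair12 ((s(x := w 1, y := w 2)) x) ((s(x := w 1, y := w 2)) y) = w"
        using pair12_eta[OF w] X(4) by simp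
      show "s(x := w 1, y := w 2) \<in> S"
        using su X by (simp add: S_def)
    qed
    also have "\<dots> = emb x y (aux_mult {1, 2} A B) s u"
      using True by (simp add: emb_def aux_mult_def)
    finally show ?thesis .
  qed
qed

lemma emb_scalar:
  assumes "x \<noteq> y"
  shows "emb x y (\<lambda>s u. c * aux_one s u) = (\<lambda>s u. c * aux_one s u :: 'a::ring_1)"
proof (intro ext)
  fix s u :: "nat \<Rightarrow> 'b"
  have "s = u \<longleftrightarrow> (\<forall>z. z \<notin> {x, y} \<longrightarrow> s z = u z) \<and> s x = u x \<and> s y = u y"
    by (auto simp: fun_eq_iff)
  then show "emb x y (\<lambda>s u. c * aux_one s u) s u = c * aux_one s u"
    unfolding emb_def aux_one_def pair12_inject
    by (cases "\<forall>z. z \<notin> {x, y} \<longrightarrow> s z = u z"; cases "s x = u x \<and> s y = u y"; cases "s = u")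
      (simp_all only: if_True if_False simp_thms mult_zero_right if_cancel)
qed

lemma emb_cong:
  assumes "aux_eq {1, 2} A B" shows "emb x y A = emb x y B"
proof (intro ext)
  fix s u
  have "A (pair12 (s x) (s y)) (pair12 (u x) (u y)) = B (pair12 (s x) (s y)) (pair12 (u x) (u y))"
    by (rule assms[unfolded aux_eq_def, THEN bspec, OF pair12_confs, THEN bspec, OF pair12_confs])
  then show "emb x y A s u = emb x y B s u" by (simp only: emb_def)
qed

lemma emb_place2:
  "emb x y (place2 A 1 2) = place2 A x y" "emb x y (place2 A 2 1) = place2 A y x"
  by (auto simp: emb_def place2_def place_def fun_eq_iff pair12_other)

lemma emb_place1:
  fixes A :: "complex^'v^'v"
  assumes "x \<noteq> y"
  shows "emb x y (place1 A 1) = place1 A x" "emb x y (place1 A 2) = place1 A y"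
proof -
  have "(\<forall>z. z \<notin> set [1] \<longrightarrow> pair12 a b z = pair12 c d z) \<longleftrightarrow> b = d"
    and "(\<forall>z. z \<notin> set [2] \<longrightarrow> pair12 a b z = pair12 c d z) \<longleftrightarrow> a = c" for a b c d :: 'v
    by (auto simp: pair12_def)
  then have 1: "place1 A 1 (pair12 a b) (pair12 c d) = (if b = d then A $ a $ c else 0)"
    and 2: "place1 A 2 (pair12 a b) (pair12 c d) = (if a = c then A $ b $ d else 0)" for a b c d
    by (simp_all only: place1_def place_def list.map nth_Cons_0 pair12_app)
  have 3: "(\<forall>z. z \<notin> set [x] \<longrightarrow> s z = u z) \<longleftrightarrow> (\<forall>z. z \<notin> {x, y} \<longrightarrow> s z = u z) \<and> s y = u y"
    and 4: "(\<forall>z. z \<notin> set [y] \<longrightarrow> s z = u z) \<longleftrightarrow> (\<forall>z. z \<notin> {x, y} \<longrightarrow> s z = u z) \<and> s x = u x"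
    for s u :: "nat \<Rightarrow> 'v"
    using assms by auto
  show "emb x y (place1 A 1) = place1 A x"
    by (intro ext) (simp only: emb_def 1 place1_def[of A x] place_def 3 if_if_eq_conj list.map nth_Cons_0)
  show "emb x y (place1 A 2) = place1 A y"
    by (intro ext) (simp only: emb_def 2 place1_def[of A y] place_def 4 if_if_eq_conj list.map nth_Cons_0)
qed

lemma emb_ptrans:
  assumes "x \<noteq> y"
  shows "emb x y (ptrans 1 A) = ptrans x (emb x y A)" "emb x y (ptrans 2 A) = ptrans y (emb x y A)"
proof -
  have 1: "(pair12 a b)(1 := c) = pair12 c b" "(pair12 a b)(2 := c) = pair12 a c" for a b c :: 'a
    by (auto simp: pair12_def fun_eq_iff)
  show "emb x y (ptrans 1 A) = ptrans x (emb x y A)" "emb x y (ptrans 2 A) = ptrans y (emb x y A)"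
    using assms by (auto simp: emb_def ptrans_def fun_eq_iff 1[simplified])
qed

lemma trivial_at_emb:
  assumes "z \<in> X" "z \<notin> {x, y}"
  shows "trivial_at X z (emb x y A)"
proof -
  have "(\<forall>w. w \<notin> {x, y} \<longrightarrow> (s(z := v)) w = (u(z := v)) w) \<longleftrightarrow> (\<forall>w. w \<notin> {x, y} \<longrightarrow> s w = u w)"
    if "s z = u z" for s u :: "nat \<Rightarrow> 'a" and v
    using that by (metis fun_upd_apply)
  then show ?thesis
    using assms unfolding trivial_at_def emb_def by auto
qed

lemma trivial_at_place2: "z \<in> X \<Longrightarrow> z \<notin> {x, y} \<Longrightarrow> trivial_at X z (place2 A x y)"
  using trivial_at_emb[of z X x y "place2 A 1 2", unfolded emb_place2] by blast

lemma trivial_at_place1: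
  assumes "z \<in> X" "z \<noteq> x" shows "trivial_at X z (place1 A x)"
  \<comment> \<open>Any label other than \<open>x\<close> and \<open>z\<close> can play the role of the second copy.\<close>
  using trivial_at_emb[of z X x "Suc (x + z)" "place1 A 1"] emb_place1(1)[of x "Suc (x + z)" A] assms
  by simp

lemma place1_inverse:
  fixes A B :: "complex^'v^'v::finite"
  assumes X: "finite X" "x \<in> X" and AB: "A ** B = mat 1"
  shows "aux_eq X (aux_mult X (place1 A x) (place1 B x)) aux_one"
  unfolding aux_eq_def
proof (intro ballI)
  fix s u :: "nat \<Rightarrow> 'v" assume su: "s \<in> confs X" "u \<in> confs X"
  show "aux_mult X (place1 A x) (place1 B x) s u = aux_one s u"
  proof (cases "\<forall>z. z \<notin> {x} \<longrightarrow> s z = u z")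
    case False
    then have "place1 A x s r * place1 B x r u = 0" for r
      by (auto simp: place1_def place_def)
    then have "aux_mult X (place1 A x) (place1 B x) s u = 0"
      unfolding aux_mult_def by (intro sum.neutral ballI)
    then show ?thesis using False by (auto simp: aux_one_def)
  next
    case True
    define S where "S = {r \<in> confs X. \<forall>z. z \<notin> {x} \<longrightarrow> s z = r z}"
    have "aux_mult X (place1 A x) (place1 B x) s u = (\<Sum>r\<in>S. place1 A x s r * place1 B x r u)"
      unfolding aux_mult_def using X(1)
      by (intro sum.mono_neutral_right) (auto simp: S_def place1_def place_def)
    also have "\<dots> = (\<Sum>a\<in>UNIV. A $ s x $ a * B $ a $ u x)"
      by (rule sum.reindex_bij_witness[of _ "\<lambda>a. s(x := a)" "\<lambda>r. r x"])
        (use su X True in \<open>auto simp: S_def place1_def place_def fun_eq_iff\<close>)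
    also have "\<dots> = (A ** B) $ s x $ u x" by (simp add: matrix_matrix_mult_def)
    also have "\<dots> = aux_one s u"
      using True by (auto simp: AB mat_def aux_one_def fun_eq_iff)
    finally show ?thesis .
  qed
qed

text \<open>Matrices on the labels 1 and 2 as square matrices with a finite index type, for which
  a left inverse is known to be a right inverse.\<close>

definition mat12 :: "('v, complex) aux \<Rightarrow> complex^('v::finite \<times> 'v)^('v \<times> 'v)" where
  "mat12 A = (\<chi> p q. A (pair12 (fst p) (snd p)) (pair12 (fst q) (snd q)))"

lemma mat12_mult: "mat12 (aux_mult {1, 2} A B) = mat12 A ** mat12 B"
proof -
  have "(\<Sum>w\<in>confs {1, 2}. A s w * B w u)
      = (\<Sum>q\<in>UNIV. A s (pair12 (fst q) (snd q)) * B (pair12 (fst q) (snd q)) u)" for s u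
    by (rule sum.reindex_bij_witness[of _ "\<lambda>q. pair12 (fst q) (snd q)" "\<lambda>w. (w 1, w 2)"])
      (simp_all only: pair12_eta pair12_confs fst_conv snd_conv pair12_app prod.collapse UNIV_I)
  then show ?thesis
    by (simp only: mat12_def aux_mult_def matrix_matrix_mult_def vec_eq_iff vec_lambda_beta simp_thms)
qed

lemma mat12_nth: "mat12 A $ (a, b) $ (c, d) = A (pair12 a b) (pair12 c d)"
  by (simp add: mat12_def)

lemma mat12_eq_iff: "mat12 A = mat12 B \<longleftrightarrow> aux_eq {1, 2} A B"
proof
  assume eq: "mat12 A = mat12 B"
  show "aux_eq {1, 2} A B"
    unfolding aux_eq_def
  proof (intro ballI)
    fix s u :: "nat \<Rightarrow> 'a" assume su: "s \<in> confs {1, 2}" "u \<in> confs {1, 2}"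
    show "A s u = B s u"
      using mat12_nth[of A "s 1" "s 2" "u 1" "u 2"] mat12_nth[of B "s 1" "s 2" "u 1" "u 2"]
      by (simp only: eq pair12_eta[OF su(1)] pair12_eta[OF su(2)])
  qed
next
  assume eq: "aux_eq {1, 2} A B"
  have "A (pair12 a b) (pair12 c d) = B (pair12 a b) (pair12 c d)" for a b c d
    by (rule eq[unfolded aux_eq_def, THEN bspec, OF pair12_confs, THEN bspec, OF pair12_confs])
  then show "mat12 A = mat12 B"
    by (simp add: mat12_def)
qed

text \<open>In finite dimension inverses are two-sided. For unitarity this shows that the scalar
  function is even, and for crossing-unitarity it allows the two factors to be exchanged.\<close>

lemma aux_inverse_commute:
  fixes A :: "('v::finite, complex) aux"
  assumes "aux_eq {1, 2} (aux_mult {1, 2} A B) (\<lambda>s u. c * aux_one s u)" "c \<noteq> 0"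
  shows "aux_eq {1, 2} (aux_mult {1, 2} B A) (\<lambda>s u. c * aux_one s u)"
proof -
  let ?A' = "\<lambda>s u. inverse c * A s u"
  have mult': "aux_mult {1, 2} ?A' B = (\<lambda>s u. inverse c * aux_mult {1, 2} A B s u)"
    "aux_mult {1, 2} B ?A' = (\<lambda>s u. inverse c * aux_mult {1, 2} B A s u)"
    by (simp_all add: aux_mult_def sum_distrib_left mult_ac fun_eq_iff)
  have one: "mat12 aux_one = (mat 1 :: complex^('v \<times> 'v)^('v \<times> 'v))"
    by (auto simp: mat12_def aux_one_def mat_def vec_eq_iff pair12_inject prod_eq_iff)
  have "aux_eq {1, 2} (aux_mult {1, 2} ?A' B) aux_one"
    unfolding mult' using assms unfolding aux_eq_def by simp
  then have "mat12 ?A' ** mat12 B = mat 1"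
    by (simp only: mat12_eq_iff[symmetric] mat12_mult one)
  then have "mat12 B ** mat12 ?A' = mat 1"
    by (rule matrix_left_right_inverse[THEN iffD1])
  then have "aux_eq {1, 2} (aux_mult {1, 2} B ?A') aux_one"
    by (simp only: mat12_eq_iff[symmetric] mat12_mult one)
  note * = this[unfolded mult' aux_eq_def, THEN bspec, THEN bspec]
  show ?thesis
    unfolding aux_eq_def
  proof (intro ballI)
    fix s u :: "nat \<Rightarrow> 'v" assume su: "s \<in> confs {1, 2}" "u \<in> confs {1, 2}"
    show "aux_mult {1, 2} B A s u = c * aux_one s u"
      unfolding *[OF su, symmetric]
      by (simp only: mult.assoc[symmetric] right_inverse[OF assms(2)] mult_1)
  qed
qed


section \<open>Ordered products in a monoid\<close>

text \<open>The order of the factors in a fused matrix: the index from \<open>xs\<close> runs faster.\<close>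

abbreviation pairs :: "('a \<Rightarrow> 'b \<Rightarrow> 'c) \<Rightarrow> 'a list \<Rightarrow> 'b list \<Rightarrow> 'c list" where
  "pairs f xs ys \<equiv> [f x y. y \<leftarrow> ys, x \<leftarrow> xs]"

lemma prod_list_commute:
  fixes a :: "'a::monoid_mult"
  assumes "\<And>b. b \<in> set bs \<Longrightarrow> a * b = b * a"
  shows "a * prod_list bs = prod_list bs * a"
  using assms
proof (induction bs)
  case (Cons b bs)
  have "a * (b * prod_list bs) = b * (a * prod_list bs)"
    using Cons.prems[of b] by (simp add: mult.assoc[symmetric])
  then show ?case using Cons by (simp add: mult.assoc)
qed simp

text \<open>A product over a rectangle may be taken by rows or by columns as soon as entries that share
  neither a row nor a column commute.\<close>

lemma prod_list_reorder:
  fixes f :: "'b \<Rightarrow> 'c \<Rightarrow> 'a::monoid_mult"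
  assumes comm: "\<And>x y x' y'. x \<noteq> x' \<Longrightarrow> y \<noteq> y' \<Longrightarrow> x \<in> set xs \<Longrightarrow> x' \<in> set xs \<Longrightarrow>
      y \<in> set ys \<Longrightarrow> y' \<in> set ys \<Longrightarrow> f x y * f x' y' = f x' y' * f x y"
    and "distinct xs" "distinct ys"
  shows "prod_list [f x y. y \<leftarrow> ys, x \<leftarrow> xs] = prod_list [f x y. x \<leftarrow> xs, y \<leftarrow> ys]"
proof -
  have step: "prod_list [f x y. x \<leftarrow> xs', y \<leftarrow> y0 # ys']
      = prod_list [f x y0. x \<leftarrow> xs'] * prod_list [f x y. x \<leftarrow> xs', y \<leftarrow> ys']"
    if "distinct xs'" "y0 \<notin> set ys'" "set xs' \<subseteq> set xs" "insert y0 (set ys') \<subseteq> set ys" for xs' y0 ys'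
    using that
  proof (induction xs')
    case (Cons x xs')
    let ?a = "prod_list [f x y. y \<leftarrow> ys']" and ?b = "prod_list [f x y0. x \<leftarrow> xs']"
    have "?b * ?a = ?a * ?b"
    proof (rule prod_list_commute)
      fix c assume "c \<in> set [f x y. y \<leftarrow> ys']"
      then obtain y where y: "c = f x y" "y \<in> set ys'" by auto
      show "?b * c = c * ?b"
      proof (rule prod_list_commute[symmetric])
        fix d assume "d \<in> set [f x y0. x \<leftarrow> xs']"
        then obtain x' where "d = f x' y0" "x' \<in> set xs'" by auto
        then show "c * d = d * c"
          using y Cons.prems by (auto intro!: comm)
      qed
    qed
    then have "?a * (?b * z) = ?b * (?a * z)" for z by (simp add: mult.assoc[symmetric])
    then show ?case using Cons by (simp add: mult.assoc)
  qed simp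
  have "prod_list [f x y. y \<leftarrow> ys', x \<leftarrow> xs] = prod_list [f x y. x \<leftarrow> xs, y \<leftarrow> ys']"
    if "distinct ys'" "set ys' \<subseteq> set ys" for ys'
    using that
  proof (induction ys')
    case Nil
    then show ?case by (induction xs) simp_all
  next
    case (Cons y ys')
    have "prod_list [f x y. x \<leftarrow> xs, y \<leftarrow> y # ys']
      = prod_list [f x y. x \<leftarrow> xs] * prod_list [f x y. x \<leftarrow> xs, y \<leftarrow> ys']"
      by (rule step) (use assms Cons.prems in auto)
    then show ?case using Cons by simp
  qed
  then show ?thesis using assms by simp
qed

text \<open>Neighbouring factors in the middle cancel to central elements, which move out.\<close>

lemma prod_list_inverse:
  fixes f g k :: "'b \<Rightarrow> 'a::monoid_mult"
  assumes "\<And>z. z \<in> set zs \<Longrightarrow> f z * g z = k z"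
    and "\<And>z z'. z \<in> set zs \<Longrightarrow> z' \<in> set zs \<Longrightarrow> k z * g z' = g z' * k z"
  shows "prod_list (map f zs) * prod_list (map g (rev zs)) = prod_list (map k zs)"
  using assms
proof (induction zs)
  case (Cons z zs)
  have "prod_list (map k zs) * g z = g z * prod_list (map k zs)"
    by (rule prod_list_commute[symmetric]) (use Cons.prems in auto)
  then have "f z * (prod_list (map f zs) * (prod_list (map g (rev zs)) * g z)) = k z * prod_list (map k zs)"
    using Cons by (simp add: mult.assoc[symmetric])
  then show ?case by (simp add: mult.assoc)
qed simp

lemma prod_list_conj:
  fixes m m' :: "'a::monoid_mult"
  assumes "m * m' = 1" "m' * m = 1"
  shows "m' * prod_list rs * m = prod_list (map (\<lambda>r. m' * r * m) rs)"
proof (induction rs)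
  case (Cons r rs)
  have "m' * (r * prod_list rs) * m = m' * r * (m * m') * prod_list rs * m"
    using assms by (simp add: mult.assoc)
  also have "\<dots> = m' * r * m * (m' * prod_list rs * m)" by (simp add: mult.assoc)
  finally show ?case using Cons by simp
qed (simp add: assms)

lemma prod_list_cancel:
  fixes g h :: "'b \<Rightarrow> 'a::monoid_mult"
  assumes "\<And>x. x \<in> set xs \<Longrightarrow> h x * g x = 1" "distinct xs"
    and "\<And>x x'. x \<in> set xs \<Longrightarrow> x' \<in> set xs \<Longrightarrow> x \<noteq> x' \<Longrightarrow> g x * h x' = h x' * g x"
  shows "prod_list (map h xs) * prod_list (map g xs) = 1"
  using assms
proof (induction xs)
  case (Cons x xs)
  have "g x * prod_list (map h xs) = prod_list (map h xs) * g x"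
    by (rule prod_list_commute) (use Cons.prems in auto)
  then have "h x * (prod_list (map h xs) * g x) * prod_list (map g xs)
     = h x * (g x * prod_list (map h xs)) * prod_list (map g xs)"
    by (simp only:)
  then have "h x * prod_list (map h xs) * (g x * prod_list (map g xs))
     = h x * g x * (prod_list (map h xs) * prod_list (map g xs))"
    by (simp only: mult.assoc)
  then show ?case using Cons by simp
qed simp

text \<open>Only the factor belonging to \<open>x0\<close> survives in a conjugation: the others pass through \<open>r\<close> and
  cancel.\<close>

lemma prod_list_conj_local:
  fixes g h :: "'b \<Rightarrow> 'a::monoid_mult"
  assumes "\<And>x. x \<in> set xs \<Longrightarrow> h x * g x = 1" "distinct xs" "x0 \<in> set xs"
    and "\<And>x x'. x \<in> set xs \<Longrightarrow> x' \<in> set xs \<Longrightarrow> x \<noteq> x' \<Longrightarrow> g x * h x' = h x' * g x"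
    and "\<And>x. x \<in> set xs \<Longrightarrow> x \<noteq> x0 \<Longrightarrow> h x * r = r * h x"
    and "\<And>x. x \<in> set xs \<Longrightarrow> x \<noteq> x0 \<Longrightarrow> g x * r = r * g x"
  shows "prod_list (map h xs) * r * prod_list (map g xs) = h x0 * r * g x0"
  using assms
proof (induction xs)
  case (Cons x xs)
  let ?h = "prod_list (map h xs)" and ?g = "prod_list (map g xs)"
  have gh: "g x * ?h = ?h * g x"
  proof (rule prod_list_commute)
    fix b assume "b \<in> set (map h xs)"
    then obtain x' where "b = h x'" "x' \<in> set xs" by auto
    then show "g x * b = b * g x" using Cons.prems(4)[of x x'] Cons.prems(2) by auto
  qed
  show ?case
  proof (cases "x = x0")
    case True
    have rh: "r * ?h = ?h * r"
    proof (rule prod_list_commute)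
      fix b assume "b \<in> set (map h xs)"
      then obtain x' where "b = h x'" "x' \<in> set xs" by auto
      then show "r * b = b * r" using Cons.prems(5)[of x', symmetric] Cons.prems(2) True by auto
    qed
    have "h x * ?h * r * (g x * ?g) = h x * (?h * r) * g x * ?g" by (simp only: mult.assoc)
    also have "\<dots> = h x * r * (?h * g x) * ?g" by (simp only: rh[symmetric] mult.assoc)
    also have "\<dots> = h x * r * g x * (?h * ?g)" by (simp only: gh[symmetric] mult.assoc)
    also have "?h * ?g = 1"
    proof (rule prod_list_cancel)
      show "g y * h y' = h y' * g y" if "y \<in> set xs" "y' \<in> set xs" "y \<noteq> y'" for y y'
        using Cons.prems(4)[of y y'] that by simp
    qed (use Cons.prems(1,2) in auto)
    finally show ?thesis using True by simp
  next
    case False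
    have gr: "g x * r = r * g x" using Cons.prems(6)[of x] False by simp
    have "h x * ?h * r * (g x * ?g) = h x * ?h * (r * g x) * ?g" by (simp only: mult.assoc)
    also have "\<dots> = h x * (?h * g x) * r * ?g" by (simp only: gr[symmetric] mult.assoc)
    also have "\<dots> = (h x * g x) * (?h * r * ?g)" by (simp only: gh[symmetric] mult.assoc)
    also have "?h * r * ?g = h x0 * r * g x0"
    proof (rule Cons.IH)
      show "g y * h y' = h y' * g y" if "y \<in> set xs" "y' \<in> set xs" "y \<noteq> y'" for y y'
        using Cons.prems(4)[of y y'] that by simp
      show "h y * r = r * h y" if "y \<in> set xs" "y \<noteq> x0" for y
        using Cons.prems(5)[of y] that by simp
      show "g y * r = r * g y" if "y \<in> set xs" "y \<noteq> x0" for y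
        using Cons.prems(6)[of y] that by simp
    qed (use Cons.prems(1-3) False in auto)
    finally show ?thesis using Cons.prems(1)[of x] by simp
  qed
qed simp

lemma map_pairs: "map F (pairs f xs ys) = pairs (\<lambda>x y. F (f x y)) xs ys"
  by (simp add: map_concat o_def)

lemma rev_pairs: "rev (pairs f xs ys) = pairs f (rev xs) (rev ys)"
  by (simp add: rev_concat rev_map o_def)


section \<open>Relations between two copies\<close>

text \<open>Not \<open>scal c\<close>: these multiply only the span of \<open>confs X\<close> by \<open>c\<close>, and are central among the
  operators \<open>mat_op X A\<close>.\<close>

definition scalar_op :: "nat set \<Rightarrow> complex \<Rightarrow> (nat \<Rightarrow> 'v::finite) operator" where
  "scalar_op X c = mat_op X (\<lambda>s u. c * aux_one s u)"

lemma mult_scalar_aux: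
  assumes "finite X"
  shows "aux_eq X (aux_mult X A (\<lambda>s u. c * aux_one s u)) (\<lambda>s u. c * A s u :: complex)"
    "aux_eq X (aux_mult X (\<lambda>s u. c * aux_one s u) A) (\<lambda>s u. c * A s u :: complex)"
proof -
  have "aux_mult X A (\<lambda>s u. c * aux_one s u) s u = c * aux_mult X A aux_one s u"
    "aux_mult X (\<lambda>s u. c * aux_one s u) A s u = c * aux_mult X aux_one A s u" for s u
    unfolding aux_mult_def sum_distrib_left by (rule sum.cong; simp)+
  then show "aux_eq X (aux_mult X A (\<lambda>s u. c * aux_one s u)) (\<lambda>s u. c * A s u :: complex)"
    "aux_eq X (aux_mult X (\<lambda>s u. c * aux_one s u) A) (\<lambda>s u. c * A s u :: complex)"
    using aux_mult_one_left[OF assms, of A] aux_mult_one_right[OF assms, of A]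
    by (simp_all add: aux_eq_def)
qed

lemma scalar_op_commute:
  assumes "finite X" shows "scalar_op X c * mat_op X A = mat_op X A * scalar_op X c"
  unfolding scalar_op_def mat_op_mult[OF assms, symmetric] mat_op_eq_iff[OF assms]
  by (rule aux_eq_trans[OF mult_scalar_aux(2)[OF assms] aux_eq_sym[OF mult_scalar_aux(1)[OF assms]]])

lemma scalar_op_mult:
  assumes "finite X" shows "scalar_op X (c * d) = scalar_op X c * scalar_op X d"
  unfolding scalar_op_def mat_op_mult[OF assms, symmetric] mat_op_eq_iff[OF assms] mult.assoc
  by (rule aux_eq_sym[OF mult_scalar_aux(2)[OF assms]])

lemma scalar_op_one: "finite X \<Longrightarrow> scalar_op X 1 = 1"
  by (simp add: scalar_op_def mat_op_one)

lemma prod_list_scalar_op: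
  assumes "finite X" "distinct zs"
  shows "prod_list (map (\<lambda>z. scalar_op X (c z)) zs) = scalar_op X (\<Prod>z\<in>set zs. c z)"
  using assms(2) by (induction zs) (simp_all add: assms(1) scalar_op_one scalar_op_mult)

lemma prod_list_pairs_scalar_op:
  assumes "finite X" "distinct xs" "distinct ys"
  shows "prod_list (pairs (\<lambda>x y. scalar_op X (c x y)) xs ys) = scalar_op X (\<Prod>y\<in>set ys. \<Prod>x\<in>set xs. c x y)"
  using assms(3) by (induction ys) (simp_all add: assms(1,2) scalar_op_one scalar_op_mult prod_list_scalar_op)

lemma pairs_inverse:
  fixes f :: "'b \<Rightarrow> 'c \<Rightarrow> (nat \<Rightarrow> 'v::finite) operator"
  assumes X: "finite X" and d: "distinct xs" "distinct ys"
    and fg: "\<And>x y. x \<in> set xs \<Longrightarrow> y \<in> set ys \<Longrightarrow> f x y * g x y = scalar_op X (c x y)"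
    and g: "\<And>x y. g x y \<in> range (mat_op X)"
  shows "prod_list (pairs f xs ys) * prod_list (pairs g (rev xs) (rev ys))
    = scalar_op X (\<Prod>y\<in>set ys. \<Prod>x\<in>set xs. c x y)"
proof -
  have "prod_list (map (case_prod f) (pairs Pair xs ys)) * prod_list (map (case_prod g) (rev (pairs Pair xs ys)))
    = prod_list (map (\<lambda>(x, y). scalar_op X (c x y)) (pairs Pair xs ys))"
  proof (rule prod_list_inverse)
    fix z z' assume "z \<in> set (pairs Pair xs ys)"
    obtain A where "case_prod g z' = mat_op X A" using g[of "fst z'" "snd z'"] by (auto simp: case_prod_unfold)
    then show "(case z of (x, y) \<Rightarrow> scalar_op X (c x y)) * case_prod g z'
        = case_prod g z' * (case z of (x, y) \<Rightarrow> scalar_op X (c x y))"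
      by (simp add: case_prod_unfold scalar_op_commute[OF X])
  qed (auto simp: fg)
  then show ?thesis
    by (simp only: rev_pairs map_pairs prod.case prod_list_pairs_scalar_op[OF X d])
qed

lemma mat_op_emb_mult:
  assumes "finite X" "x \<in> X" "y \<in> X" "x \<noteq> y"
  shows "mat_op X (emb x y A) * mat_op X (emb x y B) = mat_op X (emb x y (aux_mult {1, 2} A B))"
  unfolding mat_op_mult[OF assms(1), symmetric] mat_op_eq_iff[OF assms(1)] by (rule emb_mult[OF assms])

lemma mat_op_emb_inverse:
  assumes X: "finite X" "x \<in> X" "y \<in> X" "x \<noteq> y"
    and AB: "aux_eq {1, 2} (aux_mult {1, 2} A B) (\<lambda>s u. c * aux_one s u)"
  shows "mat_op X (emb x y A) * mat_op X (emb x y B) = scalar_op X c"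
  unfolding mat_op_emb_mult[OF X] emb_cong[OF AB] emb_scalar[OF X(4)] scalar_op_def ..

lemma finite12: "finite {1, 2 :: nat}" by simp

lemma mat_op_place2_commute:
  assumes "finite X" "{x, y} \<inter> {x', y'} = {}"
  shows "mat_op X (place2 A x y) * mat_op X (place2 B x' y') = mat_op X (place2 B x' y') * mat_op X (place2 A x y)"
  unfolding mat_op_mult[OF assms(1), symmetric] mat_op_eq_iff[OF assms(1)]
  by (rule disjoint_commute[OF assms(1)]) (use trivial_at_place2[of _ X x y A] trivial_at_place2[of _ X x' y' B] assms(2) in blast)

lemma mat_op_place1_commute:
  assumes "finite X" "x \<noteq> x'"
  shows "mat_op X (place1 A x) * mat_op X (place1 B x') = mat_op X (place1 B x') * mat_op X (place1 A x)"
  unfolding mat_op_mult[OF assms(1), symmetric] mat_op_eq_iff[OF assms(1)]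
  by (rule disjoint_commute[OF assms(1)]) (use trivial_at_place1[of _ X x A] trivial_at_place1[of _ X x' B] assms(2) in blast)

lemma mat_op_place1_place2_commute:
  assumes "finite X" "z \<notin> {x, y}"
  shows "mat_op X (place1 A z) * mat_op X (place2 B x y) = mat_op X (place2 B x y) * mat_op X (place1 A z)"
  unfolding mat_op_mult[OF assms(1), symmetric] mat_op_eq_iff[OF assms(1)]
  by (rule disjoint_commute[OF assms(1)]) (use trivial_at_place1[of _ X z A] trivial_at_place2[of _ X x y B] assms(2) in blast)

lemma mat_op_place1_inverse:
  assumes "finite X" "x \<in> X" "A ** B = mat 1"
  shows "mat_op X (place1 A x) * mat_op X (place1 B x) = 1"
  unfolding mat_op_mult[OF assms(1), symmetric] mat_op_one[OF assms(1), symmetric] mat_op_eq_iff[OF assms(1)]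
  by (rule place1_inverse[OF assms])

lemma aux_prod2: "finite X \<Longrightarrow> aux_eq X (aux_prod X [A, B]) (aux_mult X A B)"
  for A :: "('v::finite, complex) aux"
  by (simp add: mat_op_eq_iff[symmetric] mat_op_prod mat_op_mult)

text \<open>The same constant occurs for \<open>l\<close> and \<open>- l\<close>, and for all pairs of labels. Without this the
  scalars collected by exchanging the two label sets could not cancel. The implication stands
  under the existential quantifier so that the constant can be chosen as a function of \<open>l\<close>.\<close>

lemma unitarity_at:
  assumes "unitary_R E R" and fin: "finite X"
  shows "\<exists>c. l \<notin> E \<and> - l \<notin> E \<longrightarrow> c \<noteq> 0 \<and> (\<forall>x y. x \<in> X \<and> y \<in> X \<and> x \<noteq> y \<longrightarrow>
     mat_op X (place2 (R l) x y) * mat_op X (place2 (R (- l)) y x) = scalar_op X c \<and>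
     mat_op X (place2 (R (- l)) x y) * mat_op X (place2 (R l) y x) = scalar_op X c)"
proof (cases "l \<notin> E \<and> - l \<notin> E")
  case True
  then obtain c where c: "c \<noteq> 0" and
    "aux_eq {1, 2} (aux_prod {1, 2} [place2 (R l) 1 2, place2 (R (- l)) 2 1]) (\<lambda>s u. c * aux_one s u)"
    using assms unfolding unitary_R_def aux_proportional_def by blast
  from aux_eq_trans[OF aux_eq_sym[OF aux_prod2[OF finite12]] this(2)]
  have H1: "aux_eq {1, 2} (aux_mult {1, 2} (place2 (R l) 1 2) (place2 (R (- l)) 2 1)) (\<lambda>s u. c * aux_one s u)" .
  \<comment> \<open>Read on the labels in the opposite order, this is the relation for \<open>- l\<close>.\<close>
  note H2 = aux_inverse_commute[OF H1 c]
  show ?thesis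
  proof (intro exI[of _ c] conjI c allI impI; elim conjE)
    fix x y :: nat assume "x \<in> X" "y \<in> X" "x \<noteq> y"
    with fin have X: "finite X" "x \<in> X" "y \<in> X" "x \<noteq> y" by auto
    show "mat_op X (place2 (R l) x y) * mat_op X (place2 (R (- l)) y x) = scalar_op X c"
      using mat_op_emb_inverse[OF X H1] by (simp only: emb_place2)
    show "mat_op X (place2 (R (- l)) x y) * mat_op X (place2 (R l) y x) = scalar_op X c"
      using mat_op_emb_inverse[OF X(1,3,2) X(4)[symmetric] H2] by (simp only: emb_place2)
  qed
qed blast

text \<open>With \<open>M' = M\<inverse>\<close> this is \<open>M\<^sub>x\<inverse> R\<^sub>y\<^sub>x(l) M\<^sub>x\<close>, the single factor of the conjugated fused matrices in
  the dual reflection equation.\<close>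

definition twisted_R :: "nat set \<Rightarrow> (complex \<Rightarrow> complex^('v \<times> 'v)^('v::finite \<times> 'v)) \<Rightarrow>
    complex^'v^'v \<Rightarrow> complex^'v^'v \<Rightarrow> complex \<Rightarrow> nat \<Rightarrow> nat \<Rightarrow> ('v, complex) aux" where
  "twisted_R X R M M' l x y = aux_prod X [place1 M' x, place2 (R l) y x, place1 M x]"

lemma ptrans_twice: "ptrans x (ptrans x A) = A" 
  by (simp add: ptrans_def fun_eq_iff)

lemma ptrans_swap: "x \<noteq> y \<Longrightarrow> ptrans x (ptrans y A) = ptrans y (ptrans x A)"
  by (simp add: ptrans_def fun_eq_iff fun_upd_twist)

text \<open>Crossing-unitarity in the form needed under the trace: transposition in the copy \<open>y\<close>
  makes \<open>M\<^sub>x\<inverse> R\<^sub>y\<^sub>x(- l - 2\<rho>) M\<^sub>x\<close> inverse to \<open>R\<^sub>x\<^sub>y(l)\<close> up to a scalar. The symmetry of \<open>R\<close> under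
  transposition in both copies turns transposition in the first copy into transposition in the
  second with the two labels of \<open>R\<close> exchanged; the order of the factors is reversed because an
  inverse is two-sided.\<close>

lemma crossing_at:
  assumes sym: "transposition_symmetric E R" and cu: "crossing_unitary_R E \<rho> M R"
    and fin: "finite X"
  shows "\<exists>d. l \<notin> E \<and> - l - 2 * \<rho> \<notin> E \<longrightarrow> d \<noteq> 0 \<and> (\<forall>x y. x \<in> X \<and> y \<in> X \<and> x \<noteq> y \<longrightarrow>
     mat_op X (ptrans y (twisted_R X R M (matrix_inv M) (- l - 2 * \<rho>) x y)) *
       mat_op X (ptrans y (place2 (R l) x y)) = scalar_op X d)"
proof (cases "l \<notin> E \<and> - l - 2 * \<rho> \<notin> E")
  case True
  then have l: "l \<notin> E" "- l - 2 * \<rho> \<notin> E" by blast+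
  let ?l' = "- l - 2 * \<rho>" and ?M' = "matrix_inv M" and ?Z = "{1, 2 :: nat}"
  let ?o = "mat_op ?Z"
  have Z: "1 \<in> ?Z" "2 \<in> ?Z" "(1::nat) \<noteq> 2" by simp_all
  obtain d where d: "d \<noteq> 0" and "aux_eq ?Z (aux_prod ?Z [ptrans 1 (place2 (R l) 2 1), place1 ?M' 1,
      ptrans 1 (place2 (R ?l') 1 2), place1 M 1]) (\<lambda>s u. d * aux_one s u)"
    using cu l unfolding crossing_unitary_R_def aux_proportional_def by blast
  from this(2) have H: "?o (ptrans 1 (place2 (R l) 2 1)) * (?o (place1 ?M' 1) *
      (?o (ptrans 1 (place2 (R ?l') 1 2)) * ?o (place1 M 1))) = ?o (\<lambda>s u. d * aux_one s u)"
    unfolding mat_op_eq_iff[OF finite12, symmetric] mat_op_prod[OF finite12] by simp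
  have S: "ptrans 1 (place2 (R k) 2 1) = ptrans 2 (ptrans 1 (ptrans 2 (place2 (R k) 2 1)))" for k
    by (simp only: ptrans_swap[OF Z(3)] ptrans_twice)
  have S1: "?o (ptrans 1 (place2 (R k) 2 1)) = ?o (ptrans 2 (place2 (R k) 1 2))" if "k \<notin> E" for k
    unfolding mat_op_eq_iff[OF finite12] S
    by (rule ptrans_cong, rule aux_eq_sym) (use sym that in \<open>unfold transposition_symmetric_def, blast\<close>)
  have S2: "?o (ptrans 1 (place2 (R k) 1 2)) = ?o (ptrans 2 (place2 (R k) 2 1))" if "k \<notin> E" for k
  proof -
    have "?o (ptrans 1 (place2 (R k) 1 2)) = ?o (ptrans 1 (ptrans 1 (ptrans 2 (place2 (R k) 2 1))))"
      unfolding mat_op_eq_iff[OF finite12]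
      by (rule ptrans_cong) (use sym that in \<open>unfold transposition_symmetric_def, blast\<close>)
    then show ?thesis by (simp only: ptrans_twice)
  qed
  let ?F = "aux_mult ?Z (place1 ?M' 1) (aux_mult ?Z (place2 (R ?l') 2 1) (place1 M 1))"
  have t: "trivial_at ?Z 2 (place1 N 1)" for N
    by (rule trivial_at_place1) simp_all
  have "aux_eq ?Z (ptrans 2 ?F) (aux_mult ?Z (place1 ?M' 1) (ptrans 2 (aux_mult ?Z (place2 (R ?l') 2 1) (place1 M 1))))"
    by (rule ptrans_mult_left[OF finite12 Z(2) t])
  also have "aux_eq ?Z \<dots> (aux_mult ?Z (place1 ?M' 1) (aux_mult ?Z (ptrans 2 (place2 (R ?l') 2 1)) (place1 M 1)))"
    by (intro aux_eq_mult aux_eq_refl ptrans_mult_right[OF finite12 Z(2) t])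
  finally have F: "?o (ptrans 2 ?F) = ?o (place1 ?M' 1) * (?o (ptrans 2 (place2 (R ?l') 2 1)) * ?o (place1 M 1))"
    unfolding mat_op_mult[OF finite12, symmetric] mat_op_eq_iff[OF finite12] .
  have "?o (ptrans 2 (place2 (R l) 1 2)) * ?o (ptrans 2 ?F) = ?o (\<lambda>s u. d * aux_one s u)"
    unfolding F S1[OF l(1), symmetric] S2[OF l(2), symmetric] by (rule H)
  then have "aux_eq ?Z (aux_mult ?Z (ptrans 2 (place2 (R l) 1 2)) (ptrans 2 ?F)) (\<lambda>s u. d * aux_one s u)"
    unfolding mat_op_mult[OF finite12, symmetric] mat_op_eq_iff[OF finite12] .
  from aux_inverse_commute[OF this d]
  have K: "aux_eq ?Z (aux_mult ?Z (ptrans 2 ?F) (ptrans 2 (place2 (R l) 1 2))) (\<lambda>s u. d * aux_one s u)" .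
  show ?thesis
  proof (intro exI[of _ d] conjI d allI impI; elim conjE)
    fix x y :: nat assume "x \<in> X" "y \<in> X" "x \<noteq> y"
    with fin have X: "finite X" "x \<in> X" "y \<in> X" "x \<noteq> y" by auto
    have "aux_eq X (twisted_R X R M ?M' ?l' x y) (emb x y ?F)"
      unfolding twisted_R_def mat_op_eq_iff[OF X(1), symmetric] mat_op_prod[OF X(1)]
      unfolding mat_op_emb_mult[OF X, symmetric] emb_place2 emb_place1[OF X(4)] by simp
    then have "mat_op X (ptrans y (twisted_R X R M ?M' ?l' x y)) = mat_op X (ptrans y (emb x y ?F))"
      unfolding mat_op_eq_iff[OF X(1)] by (rule ptrans_cong)
    moreover have "mat_op X (emb x y (ptrans 2 ?F)) * mat_op X (emb x y (ptrans 2 (place2 (R l) 1 2))) = scalar_op X d"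
      by (rule mat_op_emb_inverse[OF X K])
    ultimately show "mat_op X (ptrans y (twisted_R X R M ?M' ?l' x y)) *
       mat_op X (ptrans y (place2 (R l) x y)) = scalar_op X d"
      by (simp only: emb_ptrans[OF X(4)] emb_place2)
  qed
qed blast

text \<open>Since \<open>M\<^sub>x M\<^sub>y\<close> commutes with \<open>R\<^sub>y\<^sub>x\<close>, conjugation by \<open>M\<^sub>y\<close> is inverse conjugation by \<open>M\<^sub>x\<close>. This
  identifies the conjugated matrices on the two sides of the dual reflection equation.\<close>

lemma twisted_R_conj:
  assumes mm: "commutes_with_MM E M R" and l: "l \<notin> E"
    and X: "finite X" "x \<in> X" "y \<in> X" "x \<noteq> y" and M: "M ** M' = mat 1" "M' ** M = mat 1"
  shows "mat_op X (place1 M y) * mat_op X (place2 (R l) y x) * mat_op X (place1 M' y)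
    = mat_op X (twisted_R X R M M' l x y)"
proof -
  have "aux_eq {1, 2} (aux_prod {1, 2} [place2 (R l) 1 2, place1 M 1, place1 M 2])
       (aux_prod {1, 2} [place1 M 1, place1 M 2, place2 (R l) 1 2])"
    using mm l unfolding commutes_with_MM_def by blast
  then have "aux_eq {1, 2} (aux_mult {1, 2} (place2 (R l) 1 2) (aux_mult {1, 2} (place1 M 1) (place1 M 2)))
       (aux_mult {1, 2} (place1 M 1) (aux_mult {1, 2} (place1 M 2) (place2 (R l) 1 2)))"
    unfolding mat_op_eq_iff[OF finite12, symmetric] mat_op_prod[OF finite12] mat_op_mult[OF finite12] by simp
  from emb_cong[OF this, of y x]
  have c: "mat_op X (place2 (R l) y x) * (mat_op X (place1 M y) * mat_op X (place1 M x))
      = mat_op X (place1 M y) * (mat_op X (place1 M x) * mat_op X (place2 (R l) y x))"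
    unfolding emb_place2(1)[of y x, symmetric] emb_place1[OF X(4)[symmetric], symmetric]
      mat_op_emb_mult[OF X(1,3,2) X(4)[symmetric]] by simp
  let ?r = "mat_op X (place2 (R l) y x)"
  let ?x = "mat_op X (place1 M x)" and ?y = "mat_op X (place1 M y)"
  let ?x' = "mat_op X (place1 M' x)" and ?y' = "mat_op X (place1 M' y)"
  have i: "?x' * ?x = 1" "?y * ?y' = 1"
    using mat_op_place1_inverse X M by blast+
  have xy: "?x * ?y = ?y * ?x" and xy': "?x * ?y' = ?y' * ?x"
    using mat_op_place1_commute X by blast+
  have "?y * ?r * ?y' = ?x' * ?x * ?y * ?r * ?y'" using i by simp
  also have "\<dots> = ?x' * (?y * (?x * ?r)) * ?y'" by (simp only: xy mult.assoc)
  also have "\<dots> = ?x' * (?r * (?y * ?x)) * ?y'" by (simp only: c)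
  also have "\<dots> = ?x' * (?r * (?x * ?y)) * ?y'" by (simp only: xy)
  also have "\<dots> = ?x' * ?r * ?x * (?y * ?y')" by (simp only: mult.assoc)
  also have "\<dots> = ?x' * ?r * ?x" using i by simp
  also have "\<dots> = mat_op X (twisted_R X R M M' l x y)"
    unfolding twisted_R_def mat_op_prod[OF X(1)] by (simp add: mult.assoc)
  finally show ?thesis .
qed


section \<open>Fused matrices\<close>

lemma mat_op_fused_R:
  "finite X \<Longrightarrow> mat_op X (fused_R X R arg xs ys) = prod_list (pairs (\<lambda>x y. mat_op X (place2 (R (arg x y)) x y)) xs ys)"
  by (simp only: fused_R_def mat_op_prod map_pairs)

lemma mat_op_fused1:
  "finite X \<Longrightarrow> mat_op X (fused1 X A xs) = prod_list (map (\<lambda>x. mat_op X (place1 A x)) xs)"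
  by (simp add: fused1_def mat_op_prod o_def)

text \<open>After the second product is taken by columns, the factors of the two products are in
  opposite orders and cancel in pairs by unitarity.\<close>

lemma fused_unitarity:
  assumes X: "finite X" "set xs \<union> set ys \<subseteq> X" and d: "distinct (xs @ ys)"
    and U: "\<And>x y. x \<in> set xs \<Longrightarrow> y \<in> set ys \<Longrightarrow>
      mat_op X (place2 (R (a x y)) x y) * mat_op X (place2 (R (b y x)) y x) = scalar_op X (c x y)"
  shows "mat_op X (fused_R X R a (rev xs) ys) * mat_op X (fused_R X R b (rev ys) xs)
    = scalar_op X (\<Prod>y\<in>set ys. \<Prod>x\<in>set xs. c x y)"
proof -
  have "prod_list (pairs (\<lambda>y x. mat_op X (place2 (R (b y x)) y x)) (rev ys) xs)
      = prod_list (pairs (\<lambda>x y. mat_op X (place2 (R (b y x)) y x)) xs (rev ys))"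
    by (rule prod_list_reorder) (use d in \<open>auto intro!: mat_op_place2_commute[OF X(1)]\<close>)
  then show ?thesis
    unfolding mat_op_fused_R[OF X(1)]
    using pairs_inverse[OF X(1), of "rev xs" ys "\<lambda>x y. mat_op X (place2 (R (a x y)) x y)"
        "\<lambda>x y. mat_op X (place2 (R (b y x)) y x)" c] U d
    by simp
qed

lemma ptr_single_label:
  assumes "finite X" "N \<subseteq> X" "y \<in> N" "\<And>z. z \<in> N - {y} \<Longrightarrow> trivial_at X z A"
  shows "aux_eq X (ptr N A) (ptrans y A)"
proof -
  have "ptr N A = ptrans y (ptr (N - {y}) A)"
    using ptr_insert[of y "N - {y}" A] assms(3) by (simp add: insert_absorb)
  moreover have "aux_eq X (ptr (N - {y}) A) A"
    by (rule ptr_trivial) (use assms finite_subset in auto)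
  ultimately show ?thesis using ptrans_cong by metis
qed

lemma aux_prod_append:
  fixes As Bs :: "('v::finite, complex) aux list"
  shows "finite X \<Longrightarrow> aux_eq X (aux_prod X (As @ Bs)) (aux_mult X (aux_prod X As) (aux_prod X Bs))"
  by (simp add: mat_op_eq_iff[symmetric] mat_op_prod mat_op_mult)

text \<open>For distinct \<open>y\<close> the factors share only copies labelled by \<open>xs\<close>, which are not transposed, so
  the order of the blocks is kept. Inside one block the factors share only the copy \<open>y\<close>, which is
  transposed, so their order is reversed.\<close>

lemma ptr_pairs:
  fixes G :: "nat \<Rightarrow> nat \<Rightarrow> ('v::finite, complex) aux"
  assumes X: "finite X" and N: "N \<subseteq> X" "set ys \<subseteq> N" and d: "distinct xs" "distinct ys" "N \<inter> set xs = {}"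
    and G: "\<And>x y z. x \<in> set xs \<Longrightarrow> y \<in> set ys \<Longrightarrow> z \<in> X \<Longrightarrow> z \<notin> {x, y} \<Longrightarrow> trivial_at X z (G x y)"
  shows "mat_op X (ptr N (aux_prod X (pairs G xs ys))) = prod_list (pairs (\<lambda>x y. mat_op X (ptrans y (G x y))) (rev xs) ys)"
proof -
  have one: "mat_op X (ptr N aux_one) = (1 :: (nat \<Rightarrow> 'v) operator)"
    unfolding mat_op_one[OF X, symmetric] mat_op_eq_iff[OF X]
    by (rule ptr_trivial) (use X N finite_subset trivial_at_one in auto)
  have row: "mat_op X (ptr N (aux_prod X (map (\<lambda>x. G x y) xs'))) = prod_list (map (\<lambda>x. mat_op X (ptrans y (G x y))) (rev xs'))"
    if "set xs' \<subseteq> set xs" "distinct xs'" "y \<in> set ys" for xs' y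
    using that
  proof (induction xs')
    case Nil
    then show ?case by (simp add: aux_prod_def one)
  next
    case (Cons x xs')
    let ?P = "aux_prod X (map (\<lambda>x. G x y) xs')"
    have "mat_op X (ptr N (aux_prod X (map (\<lambda>x. G x y) (x # xs')))) = mat_op X (ptr N (aux_mult X (G x y) ?P))"
      by (simp add: aux_prod_def)
    also have "\<dots> = mat_op X (aux_mult X (ptr N ?P) (ptr N (G x y)))"
      unfolding mat_op_eq_iff[OF X]
    proof (rule ptr_mult_rev[OF X N(1)])
      fix z assume z: "z \<in> X - N"
      show "trivial_at X z (G x y) \<or> trivial_at X z ?P"
      proof (cases "z = x")
        case True
        have "trivial_at X z ?P"
          by (rule trivial_at_prod[OF X]) (use z True Cons.prems N in \<open>auto intro!: G\<close>)
        then show ?thesis ..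
      next
        case False
        then show ?thesis using G[of x y z] z Cons.prems N by auto
      qed
    qed
    also have "\<dots> = mat_op X (ptr N ?P) * mat_op X (ptr N (G x y))" by (rule mat_op_mult[OF X])
    also have "mat_op X (ptr N (G x y)) = mat_op X (ptrans y (G x y))"
      unfolding mat_op_eq_iff[OF X]
      by (rule ptr_single_label[OF X N(1)]) (use Cons.prems N d in \<open>auto intro!: G\<close>)
    finally show ?case using Cons by simp
  qed
  have "mat_op X (ptr N (aux_prod X (pairs G xs ys'))) = prod_list (pairs (\<lambda>x y. mat_op X (ptrans y (G x y))) (rev xs) ys')"
    if "set ys' \<subseteq> set ys" "distinct ys'" for ys'
    using that
  proof (induction ys')
    case Nil
    then show ?case by (simp add: aux_prod_def one)
  next
    case (Cons y ys')
    let ?Q = "aux_prod X (map (\<lambda>x. G x y) xs)" and ?P = "aux_prod X (pairs G xs ys')"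
    have "aux_eq X (aux_prod X (pairs G xs (y # ys'))) (aux_mult X ?Q ?P)"
      using aux_prod_append[OF X] by simp
    then have "mat_op X (ptr N (aux_prod X (pairs G xs (y # ys')))) = mat_op X (ptr N (aux_mult X ?Q ?P))"
      unfolding mat_op_eq_iff[OF X] by (rule ptr_cong)
    also have "\<dots> = mat_op X (aux_mult X (ptr N ?Q) (ptr N ?P))"
      unfolding mat_op_eq_iff[OF X]
    proof (rule ptr_mult[OF X N(1)])
      fix z assume z: "z \<in> N"
      show "trivial_at X z ?Q \<or> trivial_at X z ?P"
      proof (cases "z = y")
        case True
        have "trivial_at X z ?P"
          by (rule trivial_at_prod[OF X]) (use z True Cons.prems N d in \<open>auto intro!: G\<close>)
        then show ?thesis ..
      next
        case False
        have "trivial_at X z ?Q"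
          by (rule trivial_at_prod[OF X]) (use z False Cons.prems N d in \<open>auto intro!: G\<close>)
        then show ?thesis ..
      qed
    qed
    also have "\<dots> = mat_op X (ptr N ?Q) * mat_op X (ptr N ?P)" by (rule mat_op_mult[OF X])
    also have "mat_op X (ptr N ?Q) = prod_list (map (\<lambda>x. mat_op X (ptrans y (G x y))) (rev xs))"
      by (rule row) (use Cons.prems d in auto)
    finally show ?case using Cons by simp
  qed
  then show ?thesis using d by simp
qed

text \<open>The products of \<open>F\<close> and \<open>G\<close> are in such an order that their partial transposes are in
  opposite orders and cancel in pairs.\<close>

lemma fused_crossing:
  fixes F G :: "nat \<Rightarrow> nat \<Rightarrow> ('v::finite, complex) aux"
  assumes X: "finite X" "set xs \<union> set ys \<subseteq> X" and d: "distinct (xs @ ys)"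
    and F: "\<And>x y z. x \<in> set xs \<Longrightarrow> y \<in> set ys \<Longrightarrow> z \<in> X \<Longrightarrow> z \<notin> {x, y} \<Longrightarrow> trivial_at X z (F x y)"
    and G: "\<And>x y z. x \<in> set xs \<Longrightarrow> y \<in> set ys \<Longrightarrow> z \<in> X \<Longrightarrow> z \<notin> {x, y} \<Longrightarrow> trivial_at X z (G x y)"
    and FG: "\<And>x y. x \<in> set xs \<Longrightarrow> y \<in> set ys \<Longrightarrow> mat_op X (ptrans y (F x y)) * mat_op X (ptrans y (G x y)) = scalar_op X (c x y)"
    and A: "mat_op X A = prod_list (pairs (\<lambda>y x. mat_op X (F x y)) (rev ys) (rev xs))"
    and C: "mat_op X C = prod_list (pairs (\<lambda>x y. mat_op X (G x y)) xs ys)"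
  shows "mat_op X (ptr (set ys) A) * mat_op X (ptr (set ys) C) = scalar_op X (\<Prod>y\<in>set ys. \<Prod>x\<in>set xs. c x y)"
proof -
  have "mat_op X A = prod_list (pairs (\<lambda>x y. mat_op X (F x y)) (rev xs) (rev ys))"
    unfolding A
  proof (rule prod_list_reorder)
    fix y x y' x' assume *: "y \<noteq> y'" "x \<noteq> x'" "y \<in> set (rev ys)" "y' \<in> set (rev ys)" "x \<in> set (rev xs)" "x' \<in> set (rev xs)"
    have "trivial_at X z (F x y) \<or> trivial_at X z (F x' y')" if "z \<in> X" for z
    proof (cases "z \<in> {x, y}")
      case True
      then have "z \<notin> {x', y'}" using * d by auto
      then show ?thesis using F * that by auto
    next
      case False
      then show ?thesis using F[of x y z] * that by auto
    qed
    then show "mat_op X (F x y) * mat_op X (F x' y') = mat_op X (F x' y') * mat_op X (F x y)"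
      unfolding mat_op_mult[OF X(1), symmetric] mat_op_eq_iff[OF X(1)] by (rule disjoint_commute[OF X(1)])
  qed (use d in auto)
  then have "aux_eq X A (aux_prod X (pairs F (rev xs) (rev ys)))"
    unfolding mat_op_eq_iff[OF X(1), symmetric] mat_op_prod[OF X(1)] map_pairs .
  then have "mat_op X (ptr (set ys) A) = mat_op X (ptr (set ys) (aux_prod X (pairs F (rev xs) (rev ys))))"
    unfolding mat_op_eq_iff[OF X(1)] by (rule ptr_cong)
  also have "\<dots> = prod_list (pairs (\<lambda>x y. mat_op X (ptrans y (F x y))) (rev (rev xs)) (rev ys))"
    by (rule ptr_pairs[OF X(1)]) (use X d F in auto)
  finally have 1: "mat_op X (ptr (set ys) A) = prod_list (pairs (\<lambda>x y. mat_op X (ptrans y (F x y))) xs (rev ys))"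
    by simp
  have "aux_eq X C (aux_prod X (pairs G xs ys))"
    unfolding mat_op_eq_iff[OF X(1), symmetric] mat_op_prod[OF X(1)] map_pairs C ..
  then have "mat_op X (ptr (set ys) C) = mat_op X (ptr (set ys) (aux_prod X (pairs G xs ys)))"
    unfolding mat_op_eq_iff[OF X(1)] by (rule ptr_cong)
  also have "\<dots> = prod_list (pairs (\<lambda>x y. mat_op X (ptrans y (G x y))) (rev xs) ys)"
    by (rule ptr_pairs[OF X(1)]) (use X d G in auto)
  finally have 2: "mat_op X (ptr (set ys) C) = prod_list (pairs (\<lambda>x y. mat_op X (ptrans y (G x y))) (rev xs) ys)" .
  show ?thesis
    unfolding 1 2
    using pairs_inverse[OF X(1), of xs "rev ys" "\<lambda>x y. mat_op X (ptrans y (F x y))" "\<lambda>x y. mat_op X (ptrans y (G x y))" c] FG d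
    by simp
qed

lemma trivial_at_twisted_R:
  assumes "finite X" "z \<in> X" "z \<notin> {x, y}"
  shows "trivial_at X z (twisted_R X R M M' l x y)"
  unfolding twisted_R_def
  by (rule trivial_at_prod[OF assms(1,2)])
    (use assms trivial_at_place1[OF assms(2), of x] trivial_at_place2[OF assms(2), of y x] in auto)

lemma mat_op_fused_conj_fst:
  assumes X: "finite X" "set xs \<union> set ys \<subseteq> X" and d: "distinct (xs @ ys)"
    and M: "M ** M' = mat 1" "M' ** M = mat 1"
  shows "mat_op X (aux_prod X [fused1 X M' xs, fused_R X R a (rev ys) (rev xs), fused1 X M xs])
    = prod_list (pairs (\<lambda>y x. mat_op X (twisted_R X R M M' (a y x) x y)) (rev ys) (rev xs))"
proof -
  let ?m = "prod_list (map (\<lambda>x. mat_op X (place1 M x)) xs)"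
  let ?m' = "prod_list (map (\<lambda>x. mat_op X (place1 M' x)) xs)"
  let ?r = "\<lambda>y x. mat_op X (place2 (R (a y x)) y x)"
  have inv: "mat_op X (place1 M x) * mat_op X (place1 M' x) = 1"
    "mat_op X (place1 M' x) * mat_op X (place1 M x) = 1" if "x \<in> set xs" for x
    using mat_op_place1_inverse X that M by blast+
  have "?m * ?m' = 1" "?m' * ?m = 1"
    by (rule prod_list_cancel; use d in \<open>simp add: inv mat_op_place1_commute[OF X(1)]\<close>)+
  from prod_list_conj[OF this, of "pairs ?r (rev ys) (rev xs)"]
  have "mat_op X (aux_prod X [fused1 X M' xs, fused_R X R a (rev ys) (rev xs), fused1 X M xs])
      = prod_list (pairs (\<lambda>y x. ?m' * ?r y x * ?m) (rev ys) (rev xs))"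
    by (simp add: mat_op_prod[OF X(1)] mat_op_fused1[OF X(1)] mat_op_fused_R[OF X(1)] map_concat o_def mult.assoc)
  also have "pairs (\<lambda>y x. ?m' * ?r y x * ?m) (rev ys) (rev xs)
      = pairs (\<lambda>y x. mat_op X (twisted_R X R M M' (a y x) x y)) (rev ys) (rev xs)"
  proof (intro arg_cong[where f = concat] map_cong refl)
    fix x y assume xy: "x \<in> set (rev xs)" "y \<in> set (rev ys)"
    have "?m' * ?r y x * ?m = mat_op X (place1 M' x) * ?r y x * mat_op X (place1 M x)"
    proof (rule prod_list_conj_local)
      show "mat_op X (place1 M' z) * ?r y x = ?r y x * mat_op X (place1 M' z)"
        "mat_op X (place1 M z) * ?r y x = ?r y x * mat_op X (place1 M z)" if "z \<in> set xs" "z \<noteq> x" for z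
        using that xy d by (intro mat_op_place1_place2_commute[OF X(1)]; auto)+
      show "mat_op X (place1 M z) * mat_op X (place1 M' z') = mat_op X (place1 M' z') * mat_op X (place1 M z)"
        if "z \<noteq> z'" for z z'
        by (rule mat_op_place1_commute[OF X(1) that])
    qed (use inv xy d in auto)
    then show "?m' * ?r y x * ?m = mat_op X (twisted_R X R M M' (a y x) x y)"
      by (simp add: twisted_R_def mat_op_prod[OF X(1)] mult.assoc)
  qed
  finally show ?thesis .
qed

text \<open>Conjugation by \<open>M\<close> in the labels \<open>ys\<close> yields the same factors as conjugation by \<open>M\<inverse>\<close> in the
  labels \<open>xs\<close>, which is where the commutation of \<open>R\<close> with \<open>M\<^sub>x M\<^sub>y\<close> enters.\<close>

lemma mat_op_fused_conj_snd:
  assumes mm: "commutes_with_MM E M R" and reg: "\<And>x y. x \<in> set xs \<Longrightarrow> y \<in> set ys \<Longrightarrow> a y x \<notin> E"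
    and X: "finite X" "set xs \<union> set ys \<subseteq> X" and d: "distinct (xs @ ys)"
    and M: "M ** M' = mat 1" "M' ** M = mat 1"
  shows "mat_op X (aux_prod X [fused1 X M ys, fused_R X R a (rev ys) (rev xs), fused1 X M' ys])
    = prod_list (pairs (\<lambda>y x. mat_op X (twisted_R X R M M' (a y x) x y)) (rev ys) (rev xs))"
proof -
  let ?m = "prod_list (map (\<lambda>x. mat_op X (place1 M x)) ys)"
  let ?m' = "prod_list (map (\<lambda>x. mat_op X (place1 M' x)) ys)"
  let ?r = "\<lambda>y x. mat_op X (place2 (R (a y x)) y x)"
  have inv: "mat_op X (place1 M x) * mat_op X (place1 M' x) = 1"
    "mat_op X (place1 M' x) * mat_op X (place1 M x) = 1" if "x \<in> set ys" for x
    using mat_op_place1_inverse X that M by blast+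
  have "?m' * ?m = 1" "?m * ?m' = 1"
    by (rule prod_list_cancel; use d in \<open>simp add: inv mat_op_place1_commute[OF X(1)]\<close>)+
  from prod_list_conj[OF this, of "pairs ?r (rev ys) (rev xs)"]
  have "mat_op X (aux_prod X [fused1 X M ys, fused_R X R a (rev ys) (rev xs), fused1 X M' ys])
      = prod_list (pairs (\<lambda>y x. ?m * ?r y x * ?m') (rev ys) (rev xs))"
    by (simp add: mat_op_prod[OF X(1)] mat_op_fused1[OF X(1)] mat_op_fused_R[OF X(1)] map_concat o_def mult.assoc)
  also have "pairs (\<lambda>y x. ?m * ?r y x * ?m') (rev ys) (rev xs)
      = pairs (\<lambda>y x. mat_op X (twisted_R X R M M' (a y x) x y)) (rev ys) (rev xs)"
  proof (intro arg_cong[where f = concat] map_cong refl)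
    fix x y assume xy: "x \<in> set (rev xs)" "y \<in> set (rev ys)"
    have "?m * ?r y x * ?m' = mat_op X (place1 M y) * ?r y x * mat_op X (place1 M' y)"
    proof (rule prod_list_conj_local)
      show "mat_op X (place1 M' z) * ?r y x = ?r y x * mat_op X (place1 M' z)"
        "mat_op X (place1 M z) * ?r y x = ?r y x * mat_op X (place1 M z)" if "z \<in> set ys" "z \<noteq> y" for z
        using that xy d by (intro mat_op_place1_place2_commute[OF X(1)]; auto)+
      show "mat_op X (place1 M' z) * mat_op X (place1 M z') = mat_op X (place1 M z') * mat_op X (place1 M' z)"
        if "z \<noteq> z'" for z z'
        by (rule mat_op_place1_commute[OF X(1) that])
    qed (use inv xy d in auto)
    also have "\<dots> = mat_op X (twisted_R X R M M' (a y x) x y)"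
      by (rule twisted_R_conj[OF mm _ X(1) _ _ _ M]) (use reg xy X d in auto)
    finally show "?m * ?r y x * ?m' = mat_op X (twisted_R X R M M' (a y x) x y)" .
  qed
  finally show ?thesis .
qed


section \<open>Traces over a disjoint union of labels\<close>

text \<open>Configurations on a disjoint union of label sets are pairs of configurations; sums over
  them split accordingly.\<close>

definition glue :: "nat set \<Rightarrow> (nat \<Rightarrow> 'v) \<Rightarrow> (nat \<Rightarrow> 'v) \<Rightarrow> nat \<Rightarrow> 'v" where
  "glue N p q = (\<lambda>z. if z \<in> N then p z else q z)"

lemma glue_confs [simp]: "p \<in> confs N \<Longrightarrow> q \<in> confs M \<Longrightarrow> glue N p q \<in> confs (N \<union> M)"
  by (auto simp: glue_def PiE_def extensional_def)

lemma glue_swap: "N \<inter> M = {} \<Longrightarrow> p \<in> confs N \<Longrightarrow> q \<in> confs M \<Longrightarrow> glue M q p = glue N p q"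
  by (auto simp: glue_def PiE_def extensional_def fun_eq_iff)

lemma glue_inject:
  assumes "N \<inter> M = {}" "p \<in> confs N" "q \<in> confs M" "p' \<in> confs N" "q' \<in> confs M"
  shows "glue N p q = glue N p' q' \<longleftrightarrow> p = p' \<and> q = q'"
proof
  assume eq: "glue N p q = glue N p' q'"
  have "p z = p' z \<and> q z = q' z" for z
    using fun_cong[OF eq, of z] assms by (cases "z \<in> N"; cases "z \<in> M") (auto simp: glue_def PiE_def extensional_def)
  then show "p = p' \<and> q = q'" by blast
qed simp

lemma sum_confs_Un:
  fixes f :: "(nat \<Rightarrow> 'v) \<Rightarrow> 'c::comm_monoid_add"
  assumes "N \<inter> M = {}"
  shows "(\<Sum>s\<in>confs (N \<union> M). f s) = (\<Sum>p\<in>confs N. \<Sum>q\<in>confs M. f (glue N p q))"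
proof -
  let ?i = "\<lambda>pq. glue N (fst pq) (snd pq)"
  have "(\<Sum>s\<in>confs (N \<union> M). f s) = (\<Sum>pq\<in>confs N \<times> confs M. f (?i pq))"
  proof (rule sum.reindex_bij_witness[of _ ?i "\<lambda>s. (restrict s N, restrict s M)"])
    fix s :: "nat \<Rightarrow> 'v" assume s: "s \<in> confs (N \<union> M)"
    show *: "?i (restrict s N, restrict s M) = s"
      using s by (auto simp: glue_def PiE_def extensional_def fun_eq_iff)
    show "(restrict s N, restrict s M) \<in> confs N \<times> confs M" by auto
    show "f (?i (restrict s N, restrict s M)) = f s"
      using * by simp
  next
    fix pq :: "(nat \<Rightarrow> 'v) \<times> (nat \<Rightarrow> 'v)" assume "pq \<in> confs N \<times> confs M"
    then show "(restrict (?i pq) N, restrict (?i pq) M) = pq" and "?i pq \<in> confs (N \<union> M)"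
      using assms by (auto simp: glue_def PiE_def extensional_def fun_eq_iff prod_eq_iff)
  qed
  then show ?thesis by (simp add: sum.cartesian_product case_prod_unfold)
qed

lemma place_glue:
  assumes "set ns \<inter> set ms = {}" "p \<in> confs (set ns)" "q \<in> confs (set ms)" "p' \<in> confs (set ns)" "q' \<in> confs (set ms)"
  shows "place ns A (glue (set ns) p q) (glue (set ns) p' q') = (if q = q' then A (map p ns) (map p' ns) else 0)"
    "place ms A (glue (set ns) p q) (glue (set ns) p' q') = (if p = p' then A (map q ms) (map q' ms) else 0)"
proof -
  have m: "map (glue (set ns) p q) ns = map p ns" "map (glue (set ns) p q) ms = map q ms" for p q
    using assms(1) by (auto simp: glue_def)
  have "(\<forall>z. z \<notin> set ns \<longrightarrow> glue (set ns) p q z = glue (set ns) p' q' z) \<longleftrightarrow> q = q'"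
  proof
    assume *: "\<forall>z. z \<notin> set ns \<longrightarrow> glue (set ns) p q z = glue (set ns) p' q' z"
    have "q z = q' z" for z
      using *[rule_format, of z] assms by (cases "z \<in> set ns"; cases "z \<in> set ms") (auto simp: glue_def PiE_def extensional_def)
    then show "q = q'" by blast
  qed (simp add: glue_def)
  then show "place ns A (glue (set ns) p q) (glue (set ns) p' q') = (if q = q' then A (map p ns) (map p' ns) else 0)"
    by (simp only: place_def m)
  have "(\<forall>z. z \<notin> set ms \<longrightarrow> glue (set ns) p q z = glue (set ns) p' q' z) \<longleftrightarrow> p = p'"
  proof
    assume *: "\<forall>z. z \<notin> set ms \<longrightarrow> glue (set ns) p q z = glue (set ns) p' q' z"
    have "p z = p' z" for z
      using *[rule_format, of z] assms by (cases "z \<in> set ns"; cases "z \<in> set ms") (auto simp: glue_def PiE_def extensional_def)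
    then show "p = p'" by blast
  next
    assume "p = p'"
    then show "\<forall>z. z \<notin> set ms \<longrightarrow> glue (set ns) p q z = glue (set ns) p' q' z"
      using assms by (auto simp: glue_def PiE_def extensional_def)
  qed
  then show "place ms A (glue (set ns) p q) (glue (set ns) p' q') = (if p = p' then A (map q ms) (map q' ms) else 0)"
    by (simp only: place_def m)
qed

lemma place_confs:
  assumes "p \<in> confs (set ns)" "p' \<in> confs (set ns)"
  shows "place ns A p p' = A (map p ns) (map p' ns)"
proof -
  have "\<forall>z. z \<notin> set ns \<longrightarrow> p z = p' z" using assms by (auto simp: PiE_def extensional_def)
  then show ?thesis unfolding place_def by (rule if_P)
qed

lemma cnum_eq: "cnum A s u = scal (A s u)"
  by (simp add: cnum_def scal_def)

lemma sandwich_entry: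
  fixes S T :: "'v::finite list \<Rightarrow> 'v list \<Rightarrow> 'k operator"
  assumes d: "set ns \<inter> set ms = {}" and "p \<in> confs (set ns)" "q \<in> confs (set ms)" "p' \<in> confs (set ns)" "q' \<in> confs (set ms)"
  shows "aux_prod (set ns \<union> set ms) [place ns S, cnum C, place ms T] (glue (set ns) p q) (glue (set ns) p' q')
    = (\<Sum>a\<in>confs (set ns). \<Sum>b\<in>confs (set ms).
        scal (C (glue (set ns) a q) (glue (set ns) p' b)) * (S (map p ns) (map a ns) * T (map b ms) (map q' ms)))"
proof -
  let ?N = "set ns" and ?M = "set ms" and ?m = "glue (set ns)"
  let ?X = "?N \<union> ?M"
  have u: "?m p' q' \<in> confs ?X" using assms by simp
  have W: "aux_mult ?X (place ms T) aux_one (?m a b) (?m p' q') = place ms T (?m a b) (?m p' q')"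
    if "a \<in> confs ?N" "b \<in> confs ?M" for a b
    using aux_mult_one_right[of ?X "place ms T"] that u by (simp add: aux_eq_def)
  have V: "aux_mult ?X (cnum C) (aux_mult ?X (place ms T) aux_one) (?m a b) (?m p' q')
     = (\<Sum>b'\<in>confs ?M. scal (C (?m a b) (?m p' b')) * T (map b' ms) (map q' ms))"
    if ab: "a \<in> confs ?N" "b \<in> confs ?M" for a b
  proof -
    have "aux_mult ?X (cnum C) (aux_mult ?X (place ms T) aux_one) (?m a b) (?m p' q')
      = (\<Sum>a'\<in>confs ?N. \<Sum>b'\<in>confs ?M. scal (C (?m a b) (?m a' b')) * place ms T (?m a' b') (?m p' q'))"
      unfolding aux_mult_def[of ?X "cnum C"] sum_confs_Un[OF d] cnum_eq
      by (intro sum.cong refl) (simp add: W)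
    also have "\<dots> = (\<Sum>a'\<in>confs ?N. if a' = p' then \<Sum>b'\<in>confs ?M. scal (C (?m a b) (?m a' b')) * T (map b' ms) (map q' ms) else 0)"
      by (intro sum.cong refl) (use assms in \<open>simp add: place_glue(2)[OF d]\<close>)
    also have "\<dots> = (\<Sum>b'\<in>confs ?M. scal (C (?m a b) (?m p' b')) * T (map b' ms) (map q' ms))"
      using assms by simp
    finally show ?thesis .
  qed
  have "aux_prod ?X [place ns S, cnum C, place ms T] (?m p q) (?m p' q')
    = (\<Sum>a\<in>confs ?N. \<Sum>b\<in>confs ?M. place ns S (?m p q) (?m a b) *
        (\<Sum>b'\<in>confs ?M. scal (C (?m a b) (?m p' b')) * T (map b' ms) (map q' ms)))"
    unfolding aux_prod_def foldr.simps o_def id_def aux_mult_def[of ?X "place ns S"] sum_confs_Un[OF d]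
    by (intro sum.cong refl) (simp add: V)
  also have "\<dots> = (\<Sum>a\<in>confs ?N. \<Sum>b\<in>confs ?M. if q = b then S (map p ns) (map a ns) *
        (\<Sum>b'\<in>confs ?M. scal (C (?m a b) (?m p' b')) * T (map b' ms) (map q' ms)) else 0)"
    by (intro sum.cong refl) (use assms in \<open>simp add: place_glue(1)[OF d]\<close>)
  also have "\<dots> = (\<Sum>a\<in>confs ?N. S (map p ns) (map a ns) *
        (\<Sum>b'\<in>confs ?M. scal (C (?m a q) (?m p' b')) * T (map b' ms) (map q' ms)))"
    using assms by simp
  also have "\<dots> = (\<Sum>a\<in>confs ?N. \<Sum>b\<in>confs ?M.
        scal (C (?m a q) (?m p' b)) * (S (map p ns) (map a ns) * T (map b ms) (map q' ms)))"
    unfolding sum_distrib_left mult.assoc[symmetric] scal_commute ..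
  finally show ?thesis .
qed

text \<open>The index \<open>j\<close> occurs only in the scalars, so the orthogonality relation between \<open>\<alpha>\<close> and \<open>\<gamma>\<close>
  contracts the two inner sums to a single one.\<close>

lemma partial_trace_contract:
  fixes \<beta> :: "'i \<Rightarrow> 'k operator"
  assumes "finite I" and orth: "\<And>k m. k \<in> I \<Longrightarrow> m \<in> I \<Longrightarrow> (\<Sum>j\<in>J. \<alpha> j k * \<gamma> j m) = (if k = m then d else 0)"
  shows "(\<Sum>j\<in>J. (\<Sum>k\<in>I. scal (\<alpha> j k) * \<beta> k) * (\<Sum>m\<in>I. scal (\<gamma> j m) * \<delta> m))
    = scal d * (\<Sum>k\<in>I. \<beta> k * \<delta> k)"
proof -
  have e: "scal x * b * (scal y * c) = scal (x * y) * (b * c)" for x y and b c :: "'k operator"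
    by (metis mult.assoc scal_commute scal_mult)
  have "(\<Sum>j\<in>J. (\<Sum>k\<in>I. scal (\<alpha> j k) * \<beta> k) * (\<Sum>m\<in>I. scal (\<gamma> j m) * \<delta> m))
    = (\<Sum>j\<in>J. \<Sum>k\<in>I. \<Sum>m\<in>I. scal (\<alpha> j k * \<gamma> j m) * (\<beta> k * \<delta> m))"
    by (simp only: sum_product e)
  also have "\<dots> = (\<Sum>k\<in>I. \<Sum>j\<in>J. \<Sum>m\<in>I. scal (\<alpha> j k * \<gamma> j m) * (\<beta> k * \<delta> m))"
    by (rule sum.swap)
  also have "\<dots> = (\<Sum>k\<in>I. \<Sum>m\<in>I. \<Sum>j\<in>J. scal (\<alpha> j k * \<gamma> j m) * (\<beta> k * \<delta> m))"
    by (rule sum.cong[OF refl], rule sum.swap)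
  also have "\<dots> = (\<Sum>k\<in>I. \<Sum>m\<in>I. scal (\<Sum>j\<in>J. \<alpha> j k * \<gamma> j m) * (\<beta> k * \<delta> m))"
    by (simp only: scal_sum sum_distrib_right)
  also have "\<dots> = (\<Sum>k\<in>I. \<Sum>m\<in>I. if k = m then scal d * (\<beta> k * \<delta> m) else 0)"
    by (intro sum.cong refl) (simp add: orth)
  also have "\<dots> = scal d * (\<Sum>k\<in>I. \<beta> k * \<delta> k)"
    using assms(1) by (simp add: sum_distrib_left)
  finally show ?thesis .
qed

lemma ptr_glue:
  assumes "N \<inter> M = {}" "p \<in> confs N" "q \<in> confs M" "p' \<in> confs N" "q' \<in> confs M"
  shows "ptr N A (glue N p q) (glue N p' q') = A (glue N p' q) (glue N p q')"
proof -
  have "override_on (glue N p q) (glue N p' q') N = glue N p' q"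
    for p q p' q' :: "nat \<Rightarrow> 'a"
    by (auto simp: override_on_def glue_def)
  then show ?thesis by (simp add: ptr_def)
qed

text \<open>Written out in entries, the trace of the product contains the c-numbers \<open>A\<close> and \<open>C\<close> only in the
  combination that is an entry of the product of their transposes in \<open>ns\<close>. The hypothesis
  \<open>cross\<close> therefore removes them and identifies the neighbouring indices, which leaves the
  product of two independent traces. In \<open>Xi\<close> the entries of \<open>\<kappa>\<close> on \<open>ns\<close> stand to the left of
  those on \<open>ms\<close> although the matrix indices are multiplied in the opposite order: this is the
  shape left behind by an antimorphism of the quantum algebra.\<close>

lemma trace_product:
  fixes \<kappa> \<tau> :: "('v::finite, 'k) family" and Xi Y :: "('v, 'k operator) aux"
  assumes d: "set ns \<inter> set ms = {}"
    and cross: "aux_eq (set ns \<union> set ms) (aux_mult (set ns \<union> set ms) (ptr (set ns) A) (ptr (set ns) C)) (\<lambda>s u. c * aux_one s u)"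
    and Xi: "\<And>p q p' q'. p \<in> confs (set ns) \<Longrightarrow> q \<in> confs (set ms) \<Longrightarrow> p' \<in> confs (set ns) \<Longrightarrow> q' \<in> confs (set ms) \<Longrightarrow>
      Xi (glue (set ns) p q) (glue (set ns) p' q') = (\<Sum>a\<in>confs (set ns). \<Sum>b\<in>confs (set ms).
        scal (A (glue (set ns) p b) (glue (set ns) a q')) *
          (\<kappa> (map l ns) (map a ns) (map p' ns) * \<kappa> (map l ms) (map q ms) (map b ms)))"
    and Y: "Y = aux_prod (set ns \<union> set ms) [at_labels \<tau> l ns, cnum C, at_labels \<tau> l ms]"
    and comm: "\<And>i j i' j'. \<kappa> (map l ms) i j * \<tau> (map l ns) i' j' = \<tau> (map l ns) i' j' * \<kappa> (map l ms) i j"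
  shows "aux_trace (set ns \<union> set ms) (aux_mult (set ns \<union> set ms) Xi Y) = scal c *
    (aux_trace (set ns) (aux_mult (set ns) (at_labels \<kappa> l ns) (at_labels \<tau> l ns)) *
     aux_trace (set ms) (aux_mult (set ms) (at_labels \<kappa> l ms) (at_labels \<tau> l ms)))"
proof -
  let ?N = "set ns" and ?M = "set ms" and ?m = "glue (set ns)"
  let ?P = "confs ?N :: (nat \<Rightarrow> 'v) set" and ?Q = "confs ?M :: (nat \<Rightarrow> 'v) set"
  let ?X = "?N \<union> ?M"
  define kn where "kn a b = \<kappa> (map l ns) (map a ns) (map b ns)" for a b
  define km where "km a b = \<kappa> (map l ms) (map a ms) (map b ms)" for a b
  define tn where "tn a b = \<tau> (map l ns) (map a ns) (map b ns)" for a b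
  define tm where "tm a b = \<tau> (map l ms) (map a ms) (map b ms)" for a b
  have Y': "Y (?m p' q') (?m p q) = (\<Sum>(a, b)\<in>?P \<times> ?Q. scal (C (?m a q') (?m p b)) * (tn p' a * tm b q))"
    if "p \<in> ?P" "q \<in> ?Q" "p' \<in> ?P" "q' \<in> ?Q" for p q p' q'
    unfolding Y sandwich_entry[OF d that(3,4,1,2)] tn_def tm_def sum.cartesian_product ..
  have Xi': "Xi (?m p q) (?m p' q') = (\<Sum>(a, b)\<in>?P \<times> ?Q. scal (A (?m p b) (?m a q')) * (kn a p' * km q b))"
    if "p \<in> ?P" "q \<in> ?Q" "p' \<in> ?P" "q' \<in> ?Q" for p q p' q'
    unfolding Xi[OF that] kn_def km_def sum.cartesian_product ..
  have orth: "(\<Sum>(p, q')\<in>?P \<times> ?Q. A (?m p b) (?m a q') * C (?m a' q') (?m p b')) = (if (a, b) = (a', b') then c else 0)"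
    if "a \<in> ?P" "b \<in> ?Q" "a' \<in> ?P" "b' \<in> ?Q" for a b a' b'
  proof -
    have "aux_mult ?X (ptr ?N A) (ptr ?N C) (?m a b) (?m a' b') = c * aux_one (?m a b) (?m a' b')"
      using cross that by (simp add: aux_eq_def)
    then have "(\<Sum>p\<in>?P. \<Sum>q'\<in>?Q. ptr ?N A (?m a b) (?m p q') * ptr ?N C (?m p q') (?m a' b')) = (if (a, b) = (a', b') then c else 0)"
      by (simp add: aux_mult_def sum_confs_Un[OF d] aux_one_def glue_inject[OF d that])
    then show ?thesis
      by (simp add: ptr_glue[OF d] that sum.cartesian_product[symmetric] cong: sum.cong)
  qed
  have "aux_trace ?X (aux_mult ?X Xi Y)
    = (\<Sum>p\<in>?P. \<Sum>q\<in>?Q. \<Sum>p'\<in>?P. \<Sum>q'\<in>?Q. Xi (?m p q) (?m p' q') * Y (?m p' q') (?m p q))"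
    by (simp only: aux_trace_def aux_mult_def sum_confs_Un[OF d])
  also have "\<dots> = (\<Sum>q\<in>?Q. \<Sum>p\<in>?P. \<Sum>p'\<in>?P. \<Sum>q'\<in>?Q. Xi (?m p q) (?m p' q') * Y (?m p' q') (?m p q))"
    by (rule sum.swap)
  also have "\<dots> = (\<Sum>q\<in>?Q. \<Sum>p'\<in>?P. \<Sum>p\<in>?P. \<Sum>q'\<in>?Q. Xi (?m p q) (?m p' q') * Y (?m p' q') (?m p q))"
    by (rule sum.cong[OF refl], rule sum.swap)
  also have "\<dots> = (\<Sum>q\<in>?Q. \<Sum>p'\<in>?P. scal c * (\<Sum>(a, b)\<in>?P \<times> ?Q. (kn a p' * km q b) * (tn p' a * tm b q)))"
  proof (intro sum.cong refl)
    fix q p' assume qp: "q \<in> ?Q" "p' \<in> ?P"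
    have "(\<Sum>p\<in>?P. \<Sum>q'\<in>?Q. Xi (?m p q) (?m p' q') * Y (?m p' q') (?m p q))
      = (\<Sum>j\<in>?P \<times> ?Q. (\<Sum>k\<in>?P \<times> ?Q. scal (A (?m (fst j) (snd k)) (?m (fst k) (snd j))) * (kn (fst k) p' * km q (snd k))) *
          (\<Sum>k\<in>?P \<times> ?Q. scal (C (?m (fst k) (snd j)) (?m (fst j) (snd k))) * (tn p' (fst k) * tm (snd k) q)))"
      unfolding sum.cartesian_product
      by (intro sum.cong refl) (use qp in \<open>auto simp: Xi' Y' case_prod_unfold\<close>)
    also have "\<dots> = scal c * (\<Sum>k\<in>?P \<times> ?Q. (kn (fst k) p' * km q (snd k)) * (tn p' (fst k) * tm (snd k) q))"
    proof (rule partial_trace_contract)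
      fix k m assume "k \<in> ?P \<times> ?Q" "m \<in> ?P \<times> ?Q"
      then show "(\<Sum>j\<in>?P \<times> ?Q. A (?m (fst j) (snd k)) (?m (fst k) (snd j)) * C (?m (fst m) (snd j)) (?m (fst j) (snd m)))
          = (if k = m then c else 0)"
        using orth[of "fst k" "snd k" "fst m" "snd m"] by (cases k; cases m) (simp add: case_prod_unfold)
    qed simp
    finally show "(\<Sum>p\<in>?P. \<Sum>q'\<in>?Q. Xi (?m p q) (?m p' q') * Y (?m p' q') (?m p q))
        = scal c * (\<Sum>(a, b)\<in>?P \<times> ?Q. (kn a p' * km q b) * (tn p' a * tm b q))"
      by (simp only: case_prod_unfold)
  qed
  also have "\<dots> = scal c * (\<Sum>q\<in>?Q. \<Sum>p'\<in>?P. \<Sum>a\<in>?P. \<Sum>b\<in>?Q. (kn a p' * tn p' a) * (km q b * tm b q))"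
  proof -
    have "(kn a p' * km q b) * (tn p' a * tm b q) = (kn a p' * tn p' a) * (km q b * tm b q)" for a b p' q
    proof -
      have "(kn a p' * km q b) * (tn p' a * tm b q) = kn a p' * (km q b * tn p' a) * tm b q"
        by (simp only: mult.assoc)
      also have "\<dots> = kn a p' * (tn p' a * km q b) * tm b q"
        by (simp only: km_def tn_def comm)
      finally show ?thesis by (simp only: mult.assoc)
    qed
    then show ?thesis by (simp only: sum_distrib_left sum.cartesian_product[symmetric])
  qed
  also have "(\<Sum>q\<in>?Q. \<Sum>p'\<in>?P. \<Sum>a\<in>?P. \<Sum>b\<in>?Q. (kn a p' * tn p' a) * (km q b * tm b q))
     = (\<Sum>p'\<in>?P. \<Sum>a\<in>?P. kn a p' * tn p' a) * (\<Sum>q\<in>?Q. \<Sum>b\<in>?Q. km q b * tm b q)"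
    (is "?L = ?A * ?B")
  proof -
    have "?L = (\<Sum>q\<in>?Q. \<Sum>p'\<in>?P. \<Sum>a\<in>?P. (kn a p' * tn p' a) * (\<Sum>b\<in>?Q. km q b * tm b q))"
      by (simp only: sum_distrib_left)
    also have "\<dots> = (\<Sum>q\<in>?Q. ?A * (\<Sum>b\<in>?Q. km q b * tm b q))"
      by (simp only: sum_distrib_right)
    also have "\<dots> = ?A * ?B" by (simp only: sum_distrib_left)
    finally show ?thesis .
  qed
  also have "?A = (\<Sum>a\<in>?P. \<Sum>p'\<in>?P. kn a p' * tn p' a)" for P by (rule sum.swap)
  also have "\<dots> = aux_trace ?N (aux_mult ?N (at_labels \<kappa> l ns) (at_labels \<tau> l ns))"
    by (simp add: aux_trace_def aux_mult_def place_confs kn_def tn_def cong: sum.cong)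
  also have "?B = aux_trace ?M (aux_mult ?M (at_labels \<kappa> l ms) (at_labels \<tau> l ms))"
    by (simp add: aux_trace_def aux_mult_def place_confs km_def tm_def cong: sum.cong)
  finally show ?thesis .
qed


section \<open>Intertwining relations under the trace\<close>

lemma aux_mult_one_mid:
  assumes "finite X" shows "aux_mult X A (aux_mult X aux_one B) = aux_mult X A B"
proof (intro ext)
  fix s u
  have "aux_mult X aux_one B r u = B r u" if "r \<in> confs X" for r
    using that assms by (simp add: aux_mult_def aux_one_def mult_delta_left)
  then show "aux_mult X A (aux_mult X aux_one B) s u = aux_mult X A B s u"
    by (simp add: aux_mult_def[of X A] cong: sum.cong)
qed

lemma cnum_mult: "cnum (aux_mult X A B) = aux_mult X (cnum A) (cnum B)"
  by (intro ext) (simp add: cnum_eq aux_mult_def scal_sum scal_mult)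

lemma cnum_one: "cnum aux_one = aux_one"
  by (intro ext) (simp add: cnum_eq aux_one_def)

lemma aux_mult_one_tail: "finite X \<Longrightarrow> aux_eq X (aux_mult X A (aux_mult X B aux_one)) (aux_mult X A B)"
  by (intro aux_eq_mult aux_eq_refl aux_mult_one_right)

lemma aux_trace_cong: "aux_eq X A B \<Longrightarrow> aux_trace X A = aux_trace X B"
  by (simp add: aux_trace_def aux_eq_def)

lemma aux_trace_cyclic_cnum: "aux_trace X (aux_mult X (cnum U) A) = aux_trace X (aux_mult X A (cnum U))"
proof -
  have "aux_trace X (aux_mult X (cnum U) A) = (\<Sum>s\<in>confs X. \<Sum>r\<in>confs X. scal (U s r) * A r s)"
    by (simp add: aux_trace_def aux_mult_def cnum_eq)
  also have "\<dots> = (\<Sum>r\<in>confs X. \<Sum>s\<in>confs X. scal (U s r) * A r s)" by (rule sum.swap)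
  finally show ?thesis by (simp add: aux_trace_def aux_mult_def cnum_eq scal_commute)
qed

lemma aux_trace_scalar:
  assumes "finite X" "aux_eq X W (\<lambda>s u. c * aux_one s u)"
  shows "aux_trace X (aux_mult X A (aux_mult X (cnum W) B)) = scal c * aux_trace X (aux_mult X A B)"
proof -
  have "aux_mult X (cnum W) B s u = scal c * B s u" if "s \<in> confs X" for s u
  proof -
    have "aux_mult X (cnum W) B s u = (\<Sum>r\<in>confs X. if s = r then scal c * B r u else 0)"
      unfolding aux_mult_def cnum_eq
      by (intro sum.cong refl) (use assms(2) that in \<open>simp add: aux_eq_def aux_one_def\<close>)
    then show ?thesis using that assms(1) by simp
  qed
  then have "aux_mult X A (aux_mult X (cnum W) B) s u = scal c * aux_mult X A B s u" for s u
    by (simp add: aux_mult_def[of X A] sum_distrib_left mult.assoc[symmetric] scal_commute cong: sum.cong)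
  then show ?thesis by (simp add: aux_trace_def sum_distrib_left)
qed

text \<open>Insert \<open>W U = c\<close>, rotate \<open>U\<close> to the front, exchange both factors, and absorb \<open>U' W' = c\<close>.\<close>

lemma intertwine_trace:
  assumes X: "finite X"
    and 1: "aux_eq X (aux_mult X (cnum U) X1) (aux_mult X X2 (cnum U'))"
    and 2: "aux_eq X (aux_mult X Y1 (cnum W)) (aux_mult X (cnum W') Y2)"
    and u: "aux_eq X (aux_mult X W U) (\<lambda>s u. c * aux_one s u)"
    and u': "aux_eq X (aux_mult X U' W') (\<lambda>s u. c * aux_one s u)" and c: "c \<noteq> 0"
  shows "aux_trace X (aux_mult X X1 Y1) = aux_trace X (aux_mult X X2 Y2)"
proof -
  have "scal c * aux_trace X (aux_mult X X1 Y1) = aux_trace X (aux_mult X (aux_mult X X1 Y1) (aux_mult X (cnum (aux_mult X W U)) aux_one))"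
    unfolding aux_trace_scalar[OF X u] by (rule arg_cong[OF aux_trace_cong[OF aux_eq_sym[OF aux_mult_one_right[OF X]]]])
  also have "\<dots> = aux_trace X (aux_mult X (aux_mult X X1 (aux_mult X Y1 (cnum W))) (cnum U))"
  proof (rule aux_trace_cong)
    have "aux_eq X (aux_mult X (aux_mult X X1 Y1) (aux_mult X (cnum (aux_mult X W U)) aux_one))
      (aux_mult X (aux_mult X X1 Y1) (cnum (aux_mult X W U)))"
      by (rule aux_mult_one_tail[OF X])
    then show "aux_eq X (aux_mult X (aux_mult X X1 Y1) (aux_mult X (cnum (aux_mult X W U)) aux_one))
      (aux_mult X (aux_mult X X1 (aux_mult X Y1 (cnum W))) (cnum U))"
      by (simp only: cnum_mult aux_mult_assoc)
  qed
  also have "\<dots> = aux_trace X (aux_mult X (cnum U) (aux_mult X X1 (aux_mult X Y1 (cnum W))))"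
    by (rule aux_trace_cyclic_cnum[symmetric])
  also have "\<dots> = aux_trace X (aux_mult X (aux_mult X (cnum U) X1) (aux_mult X Y1 (cnum W)))"
    by (simp only: aux_mult_assoc)
  also have "\<dots> = aux_trace X (aux_mult X (aux_mult X X2 (cnum U')) (aux_mult X (cnum W') Y2))"
    by (rule aux_trace_cong[OF aux_eq_mult[OF 1 2]])
  also have "\<dots> = aux_trace X (aux_mult X X2 (aux_mult X (cnum (aux_mult X U' W')) Y2))"
    by (simp only: cnum_mult aux_mult_assoc)
  also have "\<dots> = scal c * aux_trace X (aux_mult X X2 Y2)"
    by (rule aux_trace_scalar[OF X u'])
  finally show ?thesis using scal_cancel c by blast
qed

lemma on_left_zero: "on_left 0 = 0"
  using on_left_hom(3)[of 0] by simp

lemma on_left_sum: "on_left (\<Sum>i\<in>I. f i) = (\<Sum>i\<in>I. on_left (f i))"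
  by (induction I rule: infinite_finite_induct) (simp_all add: on_left_hom(1) on_left_zero)

lemma on_left_aux_mult:
  "(\<lambda>s u. on_left (aux_mult X A B s u)) = aux_mult X (\<lambda>s u. on_left (A s u)) (\<lambda>s u. on_left (B s u))"
  by (intro ext) (simp add: aux_mult_def on_left_sum on_left_hom)

lemma on_left_place: "(\<lambda>s u. on_left (at_labels T l ns s u)) = at_labels (entrywise on_left T) l ns"
  by (intro ext) (simp only: place_def entrywise_def if_distrib[of on_left] on_left_zero)

lemma on_left_cnum: "(\<lambda>s u. on_left (cnum A s u)) = cnum A"
  by (intro ext) (simp add: cnum_eq on_left_hom)

locale transposition =
  fixes \<A> :: "'k operator set" and t :: "'k operator \<Rightarrow> 'k operator"
  assumes t: "transposition_antimorphism \<A> t"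
begin

lemma one_in: "1 \<in> \<A>" and add_in: "a \<in> \<A> \<Longrightarrow> b \<in> \<A> \<Longrightarrow> a + b \<in> \<A>"
  and mult_in: "a \<in> \<A> \<Longrightarrow> b \<in> \<A> \<Longrightarrow> a * b \<in> \<A>" and scal_in': "a \<in> \<A> \<Longrightarrow> scal c * a \<in> \<A>"
  using t by (simp_all add: transposition_antimorphism_def unital_subalgebra_def op_scale_conv)

lemma zero_in: "0 \<in> \<A>"
  using scal_in'[OF one_in, of 0] by simp

lemma scal_in: "scal c \<in> \<A>"
  using scal_in'[OF one_in, of c] by simp

lemma sum_in: "(\<And>i. i \<in> I \<Longrightarrow> a i \<in> \<A>) \<Longrightarrow> (\<Sum>i\<in>I. a i) \<in> \<A>"
  by (induction I rule: infinite_finite_induct) (auto simp: zero_in add_in)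

text \<open>The transposition followed by the embedding into the total quantum space. It reverses products
  of entries and commutes with c-numbers, so it maps intertwining relations with c-number
  matrices to such relations.\<close>

definition \<phi> :: "'k operator \<Rightarrow> ('l \<times> 'k) operator" where "\<phi> a = on_right (t a)"

lemma \<phi>_add: "a \<in> \<A> \<Longrightarrow> b \<in> \<A> \<Longrightarrow> \<phi> (a + b) = \<phi> a + \<phi> b"
  and \<phi>_mult: "a \<in> \<A> \<Longrightarrow> b \<in> \<A> \<Longrightarrow> \<phi> (a * b) = \<phi> b * \<phi> a"
  and \<phi>_scal: "a \<in> \<A> \<Longrightarrow> \<phi> (scal c * a) = scal c * \<phi> a"
  using t by (simp_all add: transposition_antimorphism_def \<phi>_def on_right_hom op_scale_conv)

lemma \<phi>_zero: "\<phi> 0 = 0"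
  using \<phi>_scal[OF zero_in, of 0] by simp

lemma \<phi>_sum: "(\<And>i. i \<in> I \<Longrightarrow> a i \<in> \<A>) \<Longrightarrow> \<phi> (\<Sum>i\<in>I. scal (c i) * a i) = (\<Sum>i\<in>I. scal (c i) * \<phi> (a i))"
  by (induction I rule: infinite_finite_induct) (simp_all add: \<phi>_zero \<phi>_add \<phi>_scal sum_in scal_in')

definition algebra_valued :: "('v, 'k operator) aux \<Rightarrow> bool" where
  "algebra_valued A \<longleftrightarrow> (\<forall>s u. A s u \<in> \<A>)"

lemma algebra_valued_mult: "algebra_valued A \<Longrightarrow> algebra_valued B \<Longrightarrow> algebra_valued (aux_mult X A B)"
  by (simp add: algebra_valued_def aux_mult_def sum_in mult_in)

lemma algebra_valued_one: "algebra_valued aux_one"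
  by (simp add: algebra_valued_def aux_one_def one_in zero_in)

lemma algebra_valued_cnum: "algebra_valued (cnum A)"
  by (simp add: algebra_valued_def cnum_eq scal_in)

lemma algebra_valued_place:
  assumes "entries_in \<A> K" "ns \<noteq> []" shows "algebra_valued (at_labels K l ns)"
  using assms by (simp add: algebra_valued_def place_def entries_in_def zero_in)

lemma \<phi>_cnum_left:
  assumes "algebra_valued B" shows "(\<lambda>s u. \<phi> (aux_mult X (cnum U) B s u)) = aux_mult X (cnum U) (\<lambda>s u. \<phi> (B s u))"
  by (intro ext) (use assms in \<open>simp add: aux_mult_def cnum_eq \<phi>_sum algebra_valued_def\<close>)

lemma \<phi>_cnum_right:
  assumes "algebra_valued B" shows "(\<lambda>s u. \<phi> (aux_mult X B (cnum U) s u)) = aux_mult X (\<lambda>s u. \<phi> (B s u)) (cnum U)"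
  by (intro ext) (use assms in \<open>simp add: aux_mult_def cnum_eq scal_commute \<phi>_sum algebra_valued_def\<close>)

text \<open>The matrix product puts \<open>ms\<close> before \<open>ns\<close>, and the antimorphism reverses the two entries; this is
  the form required by \<open>trace_product\<close>.\<close>

lemma \<phi>_sandwich:
  fixes K :: "('v::finite, 'k) family"
  assumes d: "set ns \<inter> set ms = {}" and ne: "ns \<noteq> []" "ms \<noteq> []" and K: "entries_in \<A> K"
    and pq: "p \<in> confs (set ns)" "q \<in> confs (set ms)" "p' \<in> confs (set ns)" "q' \<in> confs (set ms)"
  defines "X \<equiv> set ns \<union> set ms" and "\<kappa> \<equiv> entrywise on_right (entrywise t K)"
  shows "\<phi> (aux_prod X [at_labels K l ms, cnum A, at_labels K l ns] (glue (set ns) p q) (glue (set ns) p' q'))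
    = (\<Sum>a\<in>confs (set ns). \<Sum>b\<in>confs (set ms).
        scal (A (glue (set ns) p b) (glue (set ns) a q')) *
          (\<kappa> (map l ns) (map a ns) (map p' ns) * \<kappa> (map l ms) (map q ms) (map b ms)))"
proof -
  let ?P = "confs (set ns) :: (nat \<Rightarrow> 'v) set" and ?Q = "confs (set ms) :: (nat \<Rightarrow> 'v) set"
  have d': "set ms \<inter> set ns = {}" using d by auto
  have in_A: "K (map l ns) (map a ns) (map b ns) \<in> \<A>" "K (map l ms) (map a ms) (map b ms) \<in> \<A>" for a b
    using K ne by (simp_all add: entries_in_def)
  have "aux_prod X [at_labels K l ms, cnum A, at_labels K l ns] (glue (set ns) p q) (glue (set ns) p' q')
    = (\<Sum>b\<in>?Q. \<Sum>a\<in>?P. scal (A (glue (set ms) b p) (glue (set ms) q' a)) *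
         (K (map l ms) (map q ms) (map b ms) * K (map l ns) (map a ns) (map p' ns)))"
    using sandwich_entry[OF d' pq(2,1,4,3), of "K (map l ms)" A "K (map l ns)"]
    by (simp only: X_def Un_commute glue_swap[OF d pq(1,2)] glue_swap[OF d pq(3,4)])
  also have "\<dots> = (\<Sum>b\<in>?Q. \<Sum>a\<in>?P. scal (A (glue (set ns) p b) (glue (set ns) a q')) *
         (K (map l ms) (map q ms) (map b ms) * K (map l ns) (map a ns) (map p' ns)))"
    by (intro sum.cong refl) (use pq in \<open>simp add: glue_swap[OF d]\<close>)
  also have "\<dots> = (\<Sum>a\<in>?P. \<Sum>b\<in>?Q. scal (A (glue (set ns) p b) (glue (set ns) a q')) *
         (K (map l ms) (map q ms) (map b ms) * K (map l ns) (map a ns) (map p' ns)))"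
    by (rule sum.swap)
  finally show ?thesis
    unfolding \<kappa>_def entrywise_def \<phi>_def[symmetric] sum.cartesian_product case_prod_unfold
    by (simp only: \<phi>_sum mult_in in_A \<phi>_mult)
qed

end


section \<open>Commuting trace operators\<close>

text \<open>\<open>V\<close> is its own inverse, hence \<open>V\<^sup>t V\<close> is invertible.\<close>

lemma crossing_M_inverse:
  assumes "V ** V = mat 1"
  shows "crossing_M V ** matrix_inv (crossing_M V) = mat 1" "matrix_inv (crossing_M V) ** crossing_M V = mat 1"
proof -
  have "transpose V ** transpose V = mat 1"
    using assms by (metis matrix_transpose_mul transpose_mat)
  then have "invertible V" "invertible (transpose V)"
    using assms by (auto simp: invertible_def)
  then have "invertible (crossing_M V)"
    unfolding crossing_M_def by (intro invertible_mult)
  then have "crossing_M V ** matrix_inv (crossing_M V) = mat 1 \<and> matrix_inv (crossing_M V) ** crossing_M V = mat 1"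
    unfolding invertible_def matrix_inv_def by (rule someI_ex)
  then show "crossing_M V ** matrix_inv (crossing_M V) = mat 1" "matrix_inv (crossing_M V) ** crossing_M V = mat 1"
    by blast+
qed

text \<open>The c-number factors between the two boundary matrices collect into one matrix, which is the
  shape treated by the trace lemmas.\<close>

lemma regroup_left:
  fixes K L :: "('v::finite, 'k operator) aux"
  assumes X: "finite X"
  shows "aux_eq X (aux_prod X [K, cnum a, cnum b, cnum c, L, cnum r])
     (aux_mult X (aux_prod X [K, cnum (aux_prod X [a, b, c]), L]) (cnum r))"
proof -
  have "aux_mult X (aux_prod X [K, cnum (aux_prod X [a, b, c]), L]) (cnum r)
    = aux_mult X K (aux_mult X (cnum a) (aux_mult X (cnum b) (aux_mult X (cnum c) (aux_mult X L (cnum r)))))"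
    by (simp add: aux_prod_def cnum_mult cnum_one aux_mult_assoc aux_mult_one_mid[OF X])
  moreover have "aux_eq X (aux_prod X [K, cnum a, cnum b, cnum c, L, cnum r])
      (aux_mult X K (aux_mult X (cnum a) (aux_mult X (cnum b) (aux_mult X (cnum c) (aux_mult X L (cnum r))))))"
    unfolding aux_prod_def foldr.simps o_def id_def
    by (intro aux_eq_mult aux_eq_refl aux_mult_one_right[OF X])
  ultimately show ?thesis by simp
qed

lemma regroup_right:
  fixes K L :: "('v::finite, 'k operator) aux"
  assumes X: "finite X"
  shows "aux_prod X [cnum r, K, cnum a, cnum b, cnum c, L]
     = aux_mult X (cnum r) (aux_prod X [K, cnum (aux_prod X [a, b, c]), L])"
  by (simp add: aux_prod_def cnum_mult cnum_one aux_mult_assoc aux_mult_one_mid[OF X])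

lemma on_left_one: "(\<lambda>s u. on_left (aux_one s u)) = aux_one"
  by (simp only: cnum_one[symmetric] on_left_cnum)

lemma on_left_aux_prod:
  "(\<lambda>s u. on_left (aux_prod X As s u)) = aux_prod X (map (\<lambda>A s u. on_left (A s u)) As)"
  by (induction As) (simp_all only: aux_prod_def foldr.simps o_def id_def list.map on_left_one on_left_aux_mult)

lemma on_left_sandwich:
  "(\<lambda>s u. on_left (aux_prod X [at_labels T l ns, cnum C, at_labels T l ms] s u))
    = aux_prod X [at_labels (entrywise on_left T) l ns, cnum C, at_labels (entrywise on_left T) l ms]"
  unfolding on_left_aux_prod list.map on_left_place[where ns = ns] on_left_place[where ns = ms] on_left_cnum ..

theorem mainTheorem3:
  fixes R :: "complex \<Rightarrow> complex^('v::finite \<times> 'v)^('v \<times> 'v)"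
    and V :: "complex^'v^'v"
    and \<rho> :: complex
    and E :: "complex set"
    and T :: "('v, 'q \<times> 'qb) family"
    and K :: "('v, 'p \<times> 'pb) family"
    and \<A> :: "('p \<times> 'pb) operator set"
    and t :: "('p \<times> 'pb) operator \<Rightarrow> ('p \<times> 'pb) operator"
  assumes "E sparse_in UNIV"
    and "standing_assumptions E \<rho> V R"
    and "transposition_antimorphism \<A> t"
    and "dual_reflection_family E \<rho> (crossing_M V) R K"
    and "entries_in \<A> K"
    and "reflection_family E R T"
  shows "\<forall>ns ms l. label_lists ns ms \<and> reflection_regular E l ns ms \<and>
           dual_reflection_regular E \<rho> l ns ms \<longrightarrow>
           trace_operator (entrywise t K) T l ns * trace_operator (entrywise t K) T l ms
         - trace_operator (entrywise t K) T l ms * trace_operator (entrywise t K) T l ns = 0"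
proof (intro allI impI; elim conjE)
  fix ns ms :: "nat list" and l :: "nat \<Rightarrow> complex"
  assume lab: "label_lists ns ms" and reg: "reflection_regular E l ns ms"
    and dreg: "dual_reflection_regular E \<rho> l ns ms"
  interpret transposition \<A> t by unfold_locales (rule assms(3))
  define X where "X = set ns \<union> set ms"
  define M where "M = crossing_M V"
  define M' where "M' = matrix_inv M"
  have X: "finite X" "set ns \<union> set ms \<subseteq> X" "set ms \<union> set ns \<subseteq> X" by (auto simp: X_def)
  have ne: "ns \<noteq> []" "ms \<noteq> []" and d: "distinct (ns @ ms)" "distinct (ms @ ns)"
    and dis: "set ns \<inter> set ms = {}" "set ms \<inter> set ns = {}"
    using lab by (auto simp: label_lists_def)
  have sa: "transposition_symmetric E R" "unitary_R E R" "crossing_unitary_R E \<rho> M R" "commutes_with_MM E M R"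
    and MM: "M ** M' = mat 1" "M' ** M = mat 1"
    using assms(2) crossing_M_inverse[of V] by (simp_all add: standing_assumptions_def M_def M'_def)
  have reg: "l x + l y \<notin> E" "- l x + l y \<notin> E" "- l x - l y - 2 * \<rho> \<notin> E" "l x - l y \<notin> E"
    if "x \<in> set ns" "y \<in> set ms" for x y
    using reg dreg that unfolding reflection_regular_def dual_reflection_regular_def by blast+
  \<comment> \<open>The scalars in the proportionalities, as functions of the spectral parameter alone.\<close>
  have "\<exists>c. \<forall>k. k \<notin> E \<and> - k \<notin> E \<longrightarrow> c k \<noteq> 0 \<and> (\<forall>x y. x \<in> X \<and> y \<in> X \<and> x \<noteq> y \<longrightarrow>
     mat_op X (place2 (R k) x y) * mat_op X (place2 (R (- k)) y x) = scalar_op X (c k) \<and>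
     mat_op X (place2 (R (- k)) x y) * mat_op X (place2 (R k) y x) = scalar_op X (c k))"
    (is "\<exists>c. \<forall>k. ?P k (c k)")
    by (rule choice, rule allI, rule unitarity_at[OF sa(2) X(1)])
  then obtain c where c': "\<forall>k. ?P k (c k)" by (elim exE)
  have c: "c k \<noteq> 0" if "k \<notin> E" "- k \<notin> E" for k
    using c'[rule_format, of k] that by blast
  have cU: "mat_op X (place2 (R k) x y) * mat_op X (place2 (R (- k)) y x) = scalar_op X (c k)"
     "mat_op X (place2 (R (- k)) x y) * mat_op X (place2 (R k) y x) = scalar_op X (c k)"
   if "k \<notin> E" "- k \<notin> E" "x \<in> X" "y \<in> X" "x \<noteq> y" for k x y
    using c'[rule_format, of k] that by blast+
  have "\<exists>g. \<forall>k. k \<notin> E \<and> - k - 2 * \<rho> \<notin> E \<longrightarrow> g k \<noteq> 0 \<and> (\<forall>x y. x \<in> X \<and> y \<in> X \<and> x \<noteq> y \<longrightarrow>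
     mat_op X (ptrans y (twisted_R X R M M' (- k - 2 * \<rho>) x y)) *
       mat_op X (ptrans y (place2 (R k) x y)) = scalar_op X (g k))"
    (is "\<exists>g. \<forall>k. ?Q k (g k)")
    unfolding M'_def by (rule choice, rule allI, rule crossing_at[OF sa(1,3) X(1)])
  then obtain g where g': "\<forall>k. ?Q k (g k)" by (elim exE)
  have g: "g k \<noteq> 0" if "k \<notin> E" "- k - 2 * \<rho> \<notin> E" for k
    using g'[rule_format, of k] that by blast
  have gU: "mat_op X (ptrans y (twisted_R X R M M' (- k - 2 * \<rho>) x y)) *
       mat_op X (ptrans y (place2 (R k) x y)) = scalar_op X (g k)"
   if "k \<notin> E" "- k - 2 * \<rho> \<notin> E" "x \<in> X" "y \<in> X" "x \<noteq> y" for k x y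
    using g'[rule_format, of k] that by blast

  define U where "U = fused_R X R (\<lambda>y x. l x - l y) (rev ms) ns"
  define U' where "U' = fused_R X R (\<lambda>x y. l x - l y) ns (rev ms)"
  define W where "W = fused_R X R (\<lambda>x y. - l x + l y) (rev ns) ms"
  define W' where "W' = fused_R X R (\<lambda>y x. - l x + l y) ms (rev ns)"
  define A1 where "A1 = aux_prod X [fused1 X M' ms, fused_R X R (\<lambda>x y. - l x - l y - 2 * \<rho>) (rev ns) (rev ms), fused1 X M ms]"
  define A2 where "A2 = aux_prod X [fused1 X M ms, fused_R X R (\<lambda>y x. - l x - l y - 2 * \<rho>) (rev ms) (rev ns), fused1 X M' ms]"
  define C1 where "C1 = fused_R X R (\<lambda>y x. l x + l y) ms ns"
  define C2 where "C2 = fused_R X R (\<lambda>x y. l x + l y) ns ms"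
  define Cu where "Cu = (\<Prod>y\<in>set ms. \<Prod>x\<in>set ns. c (- l x + l y))"
  define G where "G = (\<Prod>y\<in>set ms. \<Prod>x\<in>set ns. g (l x + l y))"
  have "c (- l x + l y) \<noteq> 0" if "x \<in> set ns" "y \<in> set ms" for x y
    by (rule c) (use reg[OF that] in simp_all)
  then have Cu: "Cu \<noteq> 0" unfolding Cu_def by (simp only: prod_zero_iff finite_set) blast
  have "g (l x + l y) \<noteq> 0" if "x \<in> set ns" "y \<in> set ms" for x y
    by (rule g) (use reg[OF that] in simp_all)
  then have G0: "G \<noteq> 0" unfolding G_def by (simp only: prod_zero_iff finite_set) blast

  have "mat_op X W * mat_op X U = scalar_op X Cu"
    unfolding W_def U_def Cu_def
  proof (rule fused_unitarity[OF X(1,2) d(1)])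
    fix x y assume xy: "x \<in> set ns" "y \<in> set ms"
    have "- (- l x + l y) = l x - l y" by simp
    then show "mat_op X (place2 (R (- l x + l y)) x y) * mat_op X (place2 (R (l x - l y)) y x) = scalar_op X (c (- l x + l y))"
      using cU(1)[of "- l x + l y" x y] reg[OF xy] xy X dis by auto
  qed
  then have WU: "aux_eq X (aux_mult X W U) (\<lambda>s u. Cu * aux_one s u)"
    unfolding scalar_op_def mat_op_mult[OF X(1), symmetric] mat_op_eq_iff[OF X(1)] .
  \<comment> \<open>The same statement with both label lists reversed; the constant is the same because \<open>c\<close> also serves the opposite argument.\<close>
  have "mat_op X U' * mat_op X W' = scalar_op X Cu"
  proof -
    have "mat_op X (fused_R X R (\<lambda>x y. l x - l y) (rev (rev ns)) (rev ms)) *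
        mat_op X (fused_R X R (\<lambda>y x. - l x + l y) (rev (rev ms)) (rev ns))
      = scalar_op X (\<Prod>y\<in>set (rev ms). \<Prod>x\<in>set (rev ns). c (- l x + l y))"
    proof (rule fused_unitarity[OF X(1)])
      fix x y assume xy: "x \<in> set (rev ns)" "y \<in> set (rev ms)"
      have "- (- l x + l y) = l x - l y" by simp
      then show "mat_op X (place2 (R (l x - l y)) x y) * mat_op X (place2 (R (- l x + l y)) y x) = scalar_op X (c (- l x + l y))"
        using cU(2)[of "- l x + l y" x y] reg[of x y] xy X dis by auto
    qed (use X d in auto)
    then show ?thesis by (simp add: U'_def W'_def Cu_def)
  qed
  then have UW': "aux_eq X (aux_mult X U' W') (\<lambda>s u. Cu * aux_one s u)"
    unfolding scalar_op_def mat_op_mult[OF X(1), symmetric] mat_op_eq_iff[OF X(1)] .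

  have "mat_op X (ptr (set ns) A1) * mat_op X (ptr (set ns) C1) = scalar_op X (\<Prod>x\<in>set ns. \<Prod>y\<in>set ms. g (l x + l y))"
  proof (rule fused_crossing[OF X(1,3) d(2)])
    show "mat_op X A1 = prod_list (pairs (\<lambda>x y. mat_op X (twisted_R X R M M' (- l x - l y - 2 * \<rho>) y x)) (rev ns) (rev ms))"
      unfolding A1_def by (rule mat_op_fused_conj_fst[OF X(1,3) d(2) MM])
    show "mat_op X C1 = prod_list (pairs (\<lambda>y x. mat_op X (place2 (R (l x + l y)) y x)) ms ns)"
      unfolding C1_def by (rule mat_op_fused_R[OF X(1)])
    fix y x assume xy: "y \<in> set ms" "x \<in> set ns"
    have "- (l x + l y) - 2 * \<rho> = - l x - l y - 2 * \<rho>" by simp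
    then show "mat_op X (ptrans x (twisted_R X R M M' (- l x - l y - 2 * \<rho>) y x)) * mat_op X (ptrans x (place2 (R (l x + l y)) y x))
        = scalar_op X (g (l x + l y))"
      using gU[of "l x + l y" y x] reg[OF xy(2,1)] xy X dis by auto
  qed (use X(1) in \<open>auto intro!: trivial_at_twisted_R trivial_at_place2\<close>)
  moreover have "(\<Prod>x\<in>set ns. \<Prod>y\<in>set ms. g (l x + l y)) = G"
    unfolding G_def by (rule prod.swap)
  ultimately have AC1: "aux_eq X (aux_mult X (ptr (set ns) A1) (ptr (set ns) C1)) (\<lambda>s u. G * aux_one s u)"
    unfolding scalar_op_def mat_op_mult[OF X(1), symmetric] mat_op_eq_iff[OF X(1), symmetric] by simp
  have "mat_op X (ptr (set ms) A2) * mat_op X (ptr (set ms) C2) = scalar_op X G"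
    unfolding G_def
  proof (rule fused_crossing[OF X(1,2) d(1)])
    show "mat_op X A2 = prod_list (pairs (\<lambda>y x. mat_op X (twisted_R X R M M' (- l x - l y - 2 * \<rho>) x y)) (rev ms) (rev ns))"
      unfolding A2_def by (rule mat_op_fused_conj_snd[OF sa(4) _ X(1,2) d(1) MM]) (use reg in auto)
    show "mat_op X C2 = prod_list (pairs (\<lambda>x y. mat_op X (place2 (R (l x + l y)) x y)) ns ms)"
      unfolding C2_def by (rule mat_op_fused_R[OF X(1)])
    fix x y assume xy: "x \<in> set ns" "y \<in> set ms"
    have "- (l x + l y) - 2 * \<rho> = - l x - l y - 2 * \<rho>" by simp
    then show "mat_op X (ptrans y (twisted_R X R M M' (- l x - l y - 2 * \<rho>) x y)) * mat_op X (ptrans y (place2 (R (l x + l y)) x y))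
        = scalar_op X (g (l x + l y))"
      using gU[of "l x + l y" x y] reg[OF xy] xy X dis by auto
  qed (use X(1) in \<open>auto intro!: trivial_at_twisted_R trivial_at_place2\<close>)
  then have AC2: "aux_eq X (aux_mult X (ptr (set ms) A2) (ptr (set ms) C2)) (\<lambda>s u. G * aux_one s u)"
    unfolding scalar_op_def mat_op_mult[OF X(1), symmetric] mat_op_eq_iff[OF X(1)] .

  let ?K = "at_labels K l" and ?T = "at_labels T l"
  \<comment> \<open>The products of boundary matrices on both sides of the two equations, without the outer c-number factor that intertwines them.\<close>
  define B1 where "B1 = aux_prod X [?K ms, cnum A1, ?K ns]"
  define B2 where "B2 = aux_prod X [?K ns, cnum A2, ?K ms]"
  define D1 where "D1 = aux_prod X [?T ns, cnum C1, ?T ms]"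
  define D2 where "D2 = aux_prod X [?T ms, cnum C2, ?T ns]"
  have "aux_eq X (aux_prod X [?K ns, cnum (fused1 X M ms), cnum (fused_R X R (\<lambda>y x. - l x - l y - 2 * \<rho>) (rev ms) (rev ns)),
             cnum (fused1 X M' ms), ?K ms, cnum U'])
      (aux_prod X [cnum U, ?K ms, cnum (fused1 X M' ms), cnum (fused_R X R (\<lambda>x y. - l x - l y - 2 * \<rho>) (rev ns) (rev ms)),
             cnum (fused1 X M ms), ?K ns])"
    using assms(4) lab dreg by (simp add: dual_reflection_family_def Let_def X_def M_def M'_def U_def U'_def)
  then have "aux_eq X (aux_mult X B2 (cnum U')) (aux_mult X (cnum U) B1)"
    unfolding regroup_right[OF X(1)] B1_def B2_def A1_def A2_def
    by (rule aux_eq_trans[OF aux_eq_sym[OF regroup_left[OF X(1)]]])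
  moreover have eB: "algebra_valued B1" "algebra_valued B2"
    unfolding B1_def B2_def aux_prod_def foldr.simps o_def id_def
    by (intro algebra_valued_mult algebra_valued_one algebra_valued_cnum algebra_valued_place assms(5) ne)+
  ultimately have KK: "aux_eq X (aux_mult X (cnum U) (\<lambda>s u. \<phi> (B1 s u))) (aux_mult X (\<lambda>s u. \<phi> (B2 s u)) (cnum U'))"
    unfolding \<phi>_cnum_left[OF eB(1), symmetric] \<phi>_cnum_right[OF eB(2), symmetric]
    by (simp add: aux_eq_def)
  have "aux_eq X (aux_prod X [?T ns, cnum C1, ?T ms, cnum W]) (aux_prod X [cnum W', ?T ms, cnum C2, ?T ns])"
    using assms(6) lab \<open>reflection_regular E l ns ms\<close>
    by (simp add: reflection_family_def Let_def X_def C1_def C2_def W_def W'_def)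
  then have RE: "aux_eq X (aux_prod X [?T ns, cnum C1, ?T ms, cnum W]) (aux_mult X (cnum W') D2)"
    by (simp only: D2_def aux_prod_def foldr.simps o_def id_def)
  have "aux_eq X (aux_prod X [?T ns, cnum C1, ?T ms, cnum W]) (aux_mult X D1 (cnum W))"
    unfolding D1_def aux_prod_def foldr.simps o_def id_def aux_mult_assoc aux_mult_one_mid[OF X(1)]
    by (intro aux_eq_mult aux_eq_refl aux_mult_one_right[OF X(1)])
  from aux_eq_trans[OF aux_eq_sym[OF this] RE]
  have TT': "aux_eq X (aux_mult X D1 (cnum W)) (aux_mult X (cnum W') D2)" .
  let ?L = "\<lambda>D :: ('v, ('q \<times> 'qb) operator) aux. (\<lambda>s u. on_left (D s u)) :: ('v, (('q \<times> 'qb) \<times> 'p \<times> 'pb) operator) aux"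
  have TT: "aux_eq X (aux_mult X (?L D1) (cnum W)) (aux_mult X (cnum W') (?L D2))"
  proof -
    have "aux_mult X (?L D1) (cnum W) = ?L (aux_mult X D1 (cnum W))"
      "aux_mult X (cnum W') (?L D2) = ?L (aux_mult X (cnum W') D2)"
      unfolding on_left_aux_mult on_left_cnum by (rule refl)+
    then show ?thesis using TT' by (simp add: aux_eq_def)
  qed

  let ?\<kappa> = "entrywise on_right (entrywise t K) :: ('v, ('q \<times> 'qb) \<times> 'p \<times> 'pb) family"
  let ?\<tau> = "entrywise on_left T :: ('v, ('q \<times> 'qb) \<times> 'p \<times> 'pb) family"
  let ?H = "trace_operator (entrywise t K) T l"
  have L1: "?L D1 = aux_prod X [at_labels ?\<tau> l ns, cnum C1, at_labels ?\<tau> l ms]"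
    and L2: "?L D2 = aux_prod X [at_labels ?\<tau> l ms, cnum C2, at_labels ?\<tau> l ns]"
    unfolding D1_def D2_def by (rule on_left_sandwich)+
  \<comment> \<open>Both traces carry the same constant \<open>G\<close>, a product over all pairs of labels, which cancels at the end.\<close>
  have H1: "aux_trace X (aux_mult X (\<lambda>s u. \<phi> (B1 s u)) (?L D1)) = scal G * (?H ns * ?H ms)"
    unfolding trace_operator_def X_def
  proof (rule trace_product[OF dis(1) AC1[unfolded X_def] _ L1[unfolded X_def]])
    show "?\<kappa> (map l ms) i j * ?\<tau> (map l ns) i' j' = ?\<tau> (map l ns) i' j' * ?\<kappa> (map l ms) i j" for i j i' j'
      by (simp add: entrywise_def on_left_right_commute)
  qed (unfold B1_def X_def, rule \<phi>_sandwich[OF dis(1) ne assms(5)])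
  have X': "X = set ms \<union> set ns" by (auto simp: X_def)
  have H2: "aux_trace X (aux_mult X (\<lambda>s u. \<phi> (B2 s u)) (?L D2)) = scal G * (?H ms * ?H ns)"
    unfolding trace_operator_def X'
  proof (rule trace_product[OF dis(2) AC2[unfolded X'] _ L2[unfolded X']])
    show "?\<kappa> (map l ns) i j * ?\<tau> (map l ms) i' j' = ?\<tau> (map l ms) i' j' * ?\<kappa> (map l ns) i j" for i j i' j'
      by (simp add: entrywise_def on_left_right_commute)
  qed (unfold B2_def X', rule \<phi>_sandwich[OF dis(2) ne(2,1) assms(5)])
  have "scal G * (?H ns * ?H ms) = scal G * (?H ms * ?H ns)"
    unfolding H1[symmetric] H2[symmetric] by (rule intertwine_trace[OF X(1) KK TT WU UW' Cu])
  then have "?H ns * ?H ms = ?H ms * ?H ns" using G0 by (rule scal_cancel)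
  then show "?H ns * ?H ms - ?H ms * ?H ns = 0" by simp
qed

end
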